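(* Let $j$ be an integer, let $\boldsymbol{\mu}$ be an $\boldsymbol{l}$-partition of $\boldsymbol{m}$, and let $\boldsymbol{\gamma}=(\gamma_1,\ldots,\gamma_n)$ where $\gamma_h$ is the order of $a_{\mu^{(h)},l_h}^{j}$. Let $\sigma\in S_m$ have cycle type $\rho_\sigma$. Then the tabloids $\{\boldsymbol{T}\}\in\mathcal{T}(\boldsymbol{\mu})$ satisfying $\sigma\{\boldsymbol{T}\}=\{\boldsymbol{T}\}a_{\boldsymbol{\mu},\boldsymbol{l}}^{-j}$ are parameterized by (i.e. are in bijection with) the marked $(\rho_\sigma,\boldsymbol{\gamma},\boldsymbol{l})$-tabloids on $\boldsymbol{\mu}$.
   Context: A partition $\mu$ is identified with its Young diagram $\{(i,j)\in\mathbb{N}^2:1\le j\le\mu_i\}$ (box $(i,j)$ in row $i$, column $j$). For a positive integer $l$, $\mu$ is an $l$-partition if for every $i$ the number of $k$ with $\mu_k=i$ is divisible by $l$. Fix $n$-tuples $\boldsymbol{m}=(m_h)$, $\boldsymbol{l}=(l_h)$ of positive integers, $m=\sum_h m_h$, $l=\operatorname{lcm}(l_h)$. An $\boldsymbol{l}$-partition of $\boldsymbol{m}$ is $\boldsymbol{\mu}=(\mu^{(1)},\ldots,\mu^{(n)})$ with $\mu^{(h)}$ an $l_h$-partition of $m_h$; its boxes are triples $(i,j;h)$, $(i,j)\in\mu^{(h)}$. A numbering on $\boldsymbol{\mu}$ is a bijection $\boldsymbol{T}$ from the boxes to $\{1,\ldots,m\}$; the standard numbering $\boldsymbol{t}_{\boldsymbol{\mu}}$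 fills $1,\ldots,m$ row by row left to right, top to bottom, in $\mu^{(1)}$, then $\mu^{(2)}$, etc. Numberings are row-equivalent if each row of each component contains the same set of numbers; the class $\{\boldsymbol{T}\}$ is a tabloid; $\mathcal{T}(\boldsymbol{\mu})$ is the set of tabloids. $S_m$ acts on the left by $\sigma\{\boldsymbol{T}\}=\{\sigma\circ\boldsymbol{T}\}$. For a single $l$-partition $\mu$ with standard numbering $t_\mu$, $a_{\mu,l}$ is the product over boxes $(lq+1,j)\in\mu$ of the cycles $(t_\mu(lq+1,j),\ldots,t_\mu(lq+l,j))$; $a_{\boldsymbol{\mu},\boldsymbol{l}}\in S_m$ is the analogous product over all $h$ and all boxes $(l_hq+1,j;h)$ of the cycles $(\boldsymbol{t}_{\boldsymbol{\mu}}(l_hq+1,j;h),\ldots,\boldsymbol{t}_{\boldsymbol{\mu}}(l_hq+l_h,j;h))$. The group $\langle a_{\boldsymbol{\mu},\boldsymbol{l}}\rangle$ acts on the right: writing $\boldsymbol{T}=\tau_{\boldsymbol{T}}\circ\boldsymbol{t}_{\boldsymbol{\mu}}$ with $\tau_{\boldsymbol{T}}\in S_m$, set $\boldsymbol{T}\sigma=\tau_{\boldsymbol{T}}\sigma\circ\boldsymbol{t}_{\boldsymbol{\mu}}$ and $\{\boldsymbol{T}\}\sigma=\{\boldsymbol{T}\sigma\}$ (concretely, row $\bar r+l_hq$ of $\mu^{(h)}$ in $\boldsymbol{T}a_{\boldsymbol{\mu},\boldsymbol{l}}$ is row $\overline{r+1}+l_hq$ of $\boldsymbol{T}$, residues taken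 in $\{1,\ldots,l_h\}$). For a partition $\rho$ of $m$ and positive integers $\gamma_h\mid l_h$, a $(\rho,\boldsymbol{\gamma},\boldsymbol{l})$-tabloid on $\boldsymbol{\mu}$ is a map $Y$ from the boxes of $\boldsymbol{\mu}$ to $\mathbb{N}$ such that: (i) $|Y^{-1}(k)|=\rho_k$ for all $k$; (ii) for each $k$ there exist $h$ and $(i',j')\in\mathbb{N}^2$ with $\gamma_h\mid\rho_k$ and $Y^{-1}(k)=\{(s\,l_h/\gamma_h+i',t+j';h):1\le s\le\gamma_h,1\le t\le\rho_k/\gamma_h\}$; (iii) $Y(i,j;h)\le Y(i,k;h)$ whenever $j\le k$. A marked $(\rho,\boldsymbol{\gamma},\boldsymbol{l})$-tabloid is a pair $(Y,c)$ with $Y$ such a tabloid and $c:\{i:\rho_i\neq0\}\to\coprod_h\mathbb{Z}/\gamma_h\mathbb{Z}$ with $c(i)\in\mathbb{Z}/\gamma_h\mathbb{Z}$ whenever $Y^{-1}(i)\subset\mu^{(h)}$.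
   Formalization: In condition (ii) the offset (i',j') ranges over pairs of integers instead of ℕ²; with ℕ² no block could meet row 1 when l_h/γ_h ≥ 2, and the claim fails (l=2, μ=(1,1), j=0, σ=id). The number n of components is assumed to be at least 1. *)

theory Defs
  imports
    "HOL-Library.Multiset"
    "HOL-Combinatorics.Cycles"
    "HOL-Combinatorics.Orbits"
    "HOL-Algebra.Sym_Groups"
    "HOL-Algebra.Elementary_Groups"
    "HOL-Algebra.Multiplicative_Group"
begin

section \<open>Partitions\<close>

text \<open>A partition is the weakly decreasing list of its nonzero parts.
  Rows, columns, parts and components are all numbered from 1.\<close>

definition partition_of :: "nat list \<Rightarrow> nat \<Rightarrow> bool" where
  "partition_of \<mu> m \<longleftrightarrow> sorted_wrt (\<ge>) \<mu> \<and> (\<forall>x\<in>set \<mu>. 0 < x) \<and> sum_list \<mu> = m"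

definition part :: "nat list \<Rightarrow> nat \<Rightarrow> nat" where
  "part \<mu> i = (if 1 \<le> i \<and> i \<le> length \<mu> then \<mu> ! (i - 1) else 0)"

definition l_partition_of :: "nat \<Rightarrow> nat list \<Rightarrow> nat \<Rightarrow> bool" where
  "l_partition_of l \<mu> m \<longleftrightarrow> partition_of \<mu> m \<and> (\<forall>i. l dvd count_list \<mu> i)"

definition cycle_type :: "nat \<Rightarrow> (nat \<Rightarrow> nat) \<Rightarrow> nat list" where
  "cycle_type m \<sigma> =
     rev (sorted_list_of_multiset (image_mset card (mset_set (Orbits.orbit \<sigma> ` {1..m}))))"

section \<open>Tuples of partitions, numberings and tabloids\<close>

text \<open>An \<open>n\<close>-tuple is a function on \<open>nat\<close> of which only the values on \<open>{1..n}\<close> are used.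
  The box \<open>(i,j;h)\<close> is the triple \<open>(i, j, h)\<close>.\<close>

type_synonym box = "nat \<times> nat \<times> nat"

definition multi_partition_of ::
  "nat \<Rightarrow> (nat \<Rightarrow> nat) \<Rightarrow> (nat \<Rightarrow> nat list) \<Rightarrow> (nat \<Rightarrow> nat) \<Rightarrow> bool" where
  "multi_partition_of n ls \<mu> ms \<longleftrightarrow> (\<forall>h\<in>{1..n}. l_partition_of (ls h) (\<mu> h) (ms h))"

definition boxes :: "nat \<Rightarrow> (nat \<Rightarrow> nat list) \<Rightarrow> box set" where
  "boxes n \<mu> = {(i, j, h). h \<in> {1..n} \<and> 1 \<le> i \<and> 1 \<le> j \<and> j \<le> part (\<mu> h) i}"

definition total_size :: "nat \<Rightarrow> (nat \<Rightarrow> nat list) \<Rightarrow> nat" where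
  "total_size n \<mu> = (\<Sum>h\<in>{1..n}. sum_list (\<mu> h))"

definition numberings :: "nat \<Rightarrow> (nat \<Rightarrow> nat list) \<Rightarrow> (box \<Rightarrow> nat) set" where
  "numberings n \<mu> =
     {T \<in> extensional (boxes n \<mu>). bij_betw T (boxes n \<mu>) {1..total_size n \<mu>}}"

definition row :: "nat \<Rightarrow> (nat \<Rightarrow> nat list) \<Rightarrow> nat \<Rightarrow> nat \<Rightarrow> box set" where
  "row n \<mu> i h = {b \<in> boxes n \<mu>. \<exists>j. b = (i, j, h)}"

definition row_equiv :: "nat \<Rightarrow> (nat \<Rightarrow> nat list) \<Rightarrow> ((box \<Rightarrow> nat) \<times> (box \<Rightarrow> nat)) set" where
  "row_equiv n \<mu> =
     {(T, T'). T \<in> numberings n \<mu> \<and> T' \<in> numberings n \<mu> \<and>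
        (\<forall>i h. T ` row n \<mu> i h = T' ` row n \<mu> i h)}"

definition tabloid :: "nat \<Rightarrow> (nat \<Rightarrow> nat list) \<Rightarrow> (box \<Rightarrow> nat) \<Rightarrow> (box \<Rightarrow> nat) set" where
  "tabloid n \<mu> T = row_equiv n \<mu> `` {T}"

definition tabloids :: "nat \<Rightarrow> (nat \<Rightarrow> nat list) \<Rightarrow> (box \<Rightarrow> nat) set set" where
  "tabloids n \<mu> = numberings n \<mu> // row_equiv n \<mu>"

section \<open>The permutations \<open>a\<close>\<close>

definition std_num1 :: "nat list \<Rightarrow> nat \<times> nat \<Rightarrow> nat" where
  "std_num1 \<mu> = (\<lambda>(i, j). (\<Sum>r\<in>{1..<i}. part \<mu> r) + j)"

definition std_num :: "nat \<Rightarrow> (nat \<Rightarrow> nat list) \<Rightarrow> box \<Rightarrow> nat" where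
  "std_num n \<mu> =
     (\<lambda>(i, j, h) \<in> boxes n \<mu>. (\<Sum>g\<in>{1..<h}. sum_list (\<mu> g)) + std_num1 (\<mu> h) (i, j))"

text \<open>The cycles attached to the boxes \<open>(l * q + 1, j)\<close> of \<open>\<mu>\<close>. They are pairwise disjoint,
  so the order in which they are multiplied is irrelevant.\<close>

definition column_cycles :: "nat \<Rightarrow> nat list \<Rightarrow> (nat \<times> nat \<Rightarrow> nat) \<Rightarrow> (nat \<Rightarrow> nat) list" where
  "column_cycles l \<mu> t =
     concat (map (\<lambda>q. map (\<lambda>j. cycle_of_list (map (\<lambda>s. t (l * q + s, j)) [1..<l + 1]))
                        [1..<part \<mu> (l * q + 1) + 1])
               [0..<length \<mu>])"

definition a_perm1 :: "nat list \<Rightarrow> nat \<Rightarrow> nat \<Rightarrow> nat" where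
  "a_perm1 \<mu> l = foldr (\<circ>) (column_cycles l \<mu> (std_num1 \<mu>)) id"

definition a_perm :: "nat \<Rightarrow> (nat \<Rightarrow> nat list) \<Rightarrow> (nat \<Rightarrow> nat) \<Rightarrow> nat \<Rightarrow> nat" where
  "a_perm n \<mu> ls =
     foldr (\<circ>)
       (concat (map (\<lambda>h. column_cycles (ls h) (\<mu> h) (\<lambda>(i, j). std_num n \<mu> (i, j, h)))
                  [1..<n + 1])) id"

section \<open>The two actions\<close>

definition left_num ::
  "nat \<Rightarrow> (nat \<Rightarrow> nat list) \<Rightarrow> (nat \<Rightarrow> nat) \<Rightarrow> (box \<Rightarrow> nat) \<Rightarrow> (box \<Rightarrow> nat)" where
  "left_num n \<mu> \<sigma> T = compose (boxes n \<mu>) \<sigma> T"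

definition tau :: "nat \<Rightarrow> (nat \<Rightarrow> nat list) \<Rightarrow> (box \<Rightarrow> nat) \<Rightarrow> (nat \<Rightarrow> nat)" where
  "tau n \<mu> T =
     (THE \<tau>. \<tau> permutes {1..total_size n \<mu>} \<and> T = compose (boxes n \<mu>) \<tau> (std_num n \<mu>))"

definition right_num ::
  "nat \<Rightarrow> (nat \<Rightarrow> nat list) \<Rightarrow> (box \<Rightarrow> nat) \<Rightarrow> (nat \<Rightarrow> nat) \<Rightarrow> (box \<Rightarrow> nat)" where
  "right_num n \<mu> T \<sigma> = compose (boxes n \<mu>) (tau n \<mu> T \<circ> \<sigma>) (std_num n \<mu>)"

text \<open>The induced actions on row-equivalence classes, lifted through representatives.
  The right action is meant only for \<open>\<sigma>\<close> in the group generated by \<open>a_perm n \<mu> ls\<close>,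
  for which it does not depend on the representative.\<close>

definition left_tabloid ::
  "nat \<Rightarrow> (nat \<Rightarrow> nat list) \<Rightarrow> (nat \<Rightarrow> nat) \<Rightarrow> (box \<Rightarrow> nat) set \<Rightarrow> (box \<Rightarrow> nat) set" where
  "left_tabloid n \<mu> \<sigma> X = (\<Union>T\<in>X. tabloid n \<mu> (left_num n \<mu> \<sigma> T))"

definition right_tabloid ::
  "nat \<Rightarrow> (nat \<Rightarrow> nat list) \<Rightarrow> (box \<Rightarrow> nat) set \<Rightarrow> (nat \<Rightarrow> nat) \<Rightarrow> (box \<Rightarrow> nat) set" where
  "right_tabloid n \<mu> X \<sigma> = (\<Union>T\<in>X. tabloid n \<mu> (right_num n \<mu> T \<sigma>))"

section \<open>Marked tabloids\<close>

definition preim :: "nat \<Rightarrow> (nat \<Rightarrow> nat list) \<Rightarrow> (box \<Rightarrow> nat) \<Rightarrow> nat \<Rightarrow> box set" where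
  "preim n \<mu> Y k = {b \<in> boxes n \<mu>. Y b = k}"

text \<open>Coordinates are compared in the integers because the offset \<open>(i', j')\<close> of a block may have
  \<open>i' < 0\<close>: a block meeting row 1 has \<open>i' = 1 - l / \<gamma>\<close>. The division \<open>ls h div \<gamma> h\<close> is exact, as
  these tabloids are only considered for \<open>\<gamma> h\<close> dividing \<open>ls h\<close>.\<close>

definition rho_tabloids ::
  "nat list \<Rightarrow> (nat \<Rightarrow> nat) \<Rightarrow> nat \<Rightarrow> (nat \<Rightarrow> nat) \<Rightarrow> (nat \<Rightarrow> nat list) \<Rightarrow> (box \<Rightarrow> nat) set" where
  "rho_tabloids \<rho> \<gamma> n ls \<mu> =
     {Y \<in> boxes n \<mu> \<rightarrow>\<^sub>E {1..}.
        (\<forall>k\<ge>1. card (preim n \<mu> Y k) = part \<rho> k) \<and>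
        (\<forall>k\<ge>1. \<exists>h\<in>{1..n}. \<exists>i' j' :: int. \<gamma> h dvd part \<rho> k \<and>
           (\<lambda>(i, j, h). (int i, int j, h)) ` preim n \<mu> Y k =
             {(int s * int (ls h div \<gamma> h) + i', int t + j', h) | s t.
                1 \<le> s \<and> s \<le> \<gamma> h \<and> 1 \<le> t \<and> t \<le> part \<rho> k div \<gamma> h}) \<and>
        (\<forall>i j k h. (i, j, h) \<in> boxes n \<mu> \<and> (i, k, h) \<in> boxes n \<mu> \<and> j \<le> k \<longrightarrow>
           Y (i, j, h) \<le> Y (i, k, h))}"

text \<open>The coproduct of the \<open>\<int>/\<gamma>\<^sub>h\<int>\<close> is the set of pairs \<open>(h, x)\<close> with \<open>x\<close> in \<open>\<int>/\<gamma>\<^sub>h\<int>\<close>.\<close>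

definition marked_tabloids ::
  "nat list \<Rightarrow> (nat \<Rightarrow> nat) \<Rightarrow> nat \<Rightarrow> (nat \<Rightarrow> nat) \<Rightarrow> (nat \<Rightarrow> nat list) \<Rightarrow>
     ((box \<Rightarrow> nat) \<times> (nat \<Rightarrow> nat \<times> int)) set" where
  "marked_tabloids \<rho> \<gamma> n ls \<mu> =
     {(Y, c). Y \<in> rho_tabloids \<rho> \<gamma> n ls \<mu> \<and>
        c \<in> {k. part \<rho> k \<noteq> 0} \<rightarrow>\<^sub>E (SIGMA h:{1..n}. carrier (integer_mod_group (\<gamma> h))) \<and>
        (\<forall>k h. part \<rho> k \<noteq> 0 \<and> h \<in> {1..n} \<and> preim n \<mu> Y k \<subseteq> {(i, j, h') | i j h'. h' = h} \<longrightarrow>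
           fst (c k) = h)}"

end

theory Submission
  imports Defs
begin

text \<open>A tabloid is the same thing as a map \<open>R\<close> from \<open>{1..m}\<close> to the rows of the diagrams with
  prescribed fibre sizes, and the fixed-point condition says that \<open>R (\<sigma> x)\<close> is \<open>R x\<close> rotated by \<open>-j\<close>
  within its group of \<open>l\<^sub>h\<close> equal rows. Such an equivariant map is determined by its values at one
  representative of every cycle of \<open>\<sigma>\<close>. A cycle of length \<open>\<rho>\<^sub>k\<close> starting in a row of component \<open>h\<close>
  meets each of the \<open>\<gamma>\<^sub>h\<close> rows of the rotation class of that row in \<open>\<rho>\<^sub>k / \<gamma>\<^sub>h\<close> numbers. Writing, in
  increasing order, every \<open>k\<close> into each row as often as the \<open>k\<close>-th cycle meets it yields \<open>Y\<close>, and the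
  position of the starting row inside its class is the mark. Conversely, since rows of \<open>Y\<close> are weakly
  increasing, \<open>Y\<close> is determined by the classes of its blocks, and every block spans exactly the rows of one class.\<close>

section \<open>Rotation of rows\<close>

text \<open>Both sides are compared with the set \<open>assignments\<close> of maps \<open>F\<close>
  from cycles to rows, where \<open>F k\<close> is the row of a chosen element of the k-th cycle.
  The bijection depends on these choices and on the order given to cycles of equal length. The sign:
  in \<sigma>T the number x sits where \<sigma>^-1 x sat in T, and T a^k at a box is T at the box
  shifted by k, so its row map is rotated by -k. With k = -j the fixed-point equation says that R
  (\<sigma> x) is R x rotated by -j. The constants: the multiples of j modulo l are the multiples of
  gcd(l, j). A class therefore consists of \<gamma> = l / gcd(l, j) rows at distance l / \<gamma>,
  which is the vertical spacing in condition (ii), and \<gamma> is also the order of a^j. The blocks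
  of Y are rectangles of columns because the multiplicity of k in a row depends only on the class of
  the row, and rows of one class have equal length. The delicate direction is the converse:
  condition (ii) allows a block to start in any row, and that it starts at the first row of a class
  has to be deduced from the way the blocks tile the diagram from the top.\<close>

text \<open>Rows are numbered from 1, and \<open>(i - 1) div l\<close> is the group of \<open>l\<close> consecutive rows containing
  row \<open>i\<close>; \<open>shift\<close> rotates each group. For \<open>g = gcd l j\<close>, the rows reachable from \<open>i\<close> under repeated
  shifts by \<open>j\<close> are those congruent to \<open>i\<close> modulo \<open>g\<close> in its group; \<open>class_base\<close> is the first of them
  and \<open>class_offset\<close> the position of \<open>i\<close> among them, counted from 0.\<close>

definition shift :: "nat \<Rightarrow> int \<Rightarrow> nat \<Rightarrow> nat" where
  "shift l k i = l * ((i - 1) div l) + nat ((int (i - 1) + k) mod int l) + 1"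

definition class_base :: "nat \<Rightarrow> nat \<Rightarrow> nat \<Rightarrow> nat" where
  "class_base l g i = l * ((i - 1) div l) + (i - 1) mod g + 1"

definition class_offset :: "nat \<Rightarrow> nat \<Rightarrow> nat \<Rightarrow> nat" where
  "class_offset l g i = ((i - 1) mod l) div g"

lemma shift_ge_1 [simp]: "Suc 0 \<le> shift l k i" "0 < shift l k i"
  by (simp_all add: shift_def)

lemma shift_block:
  assumes "l > 0"
  shows "(shift l k i - 1) div l = (i - 1) div l"
proof -
  have "nat ((int (i - 1) + k) mod int l) < l"
    using assms by (simp add: nat_less_iff)
  then show ?thesis by (simp add: shift_def)
qed

lemma shift_cong:
  assumes "l > 0"
  shows "int (shift l k i - 1) mod int l = (int (i - 1) + k) mod int l"
  using assms by (simp add: shift_def)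

text \<open>A row is determined by the quotient and the remainder of i - 1 by l. A shift keeps the
  quotient, so only a congruence remains; stated as a divisibility in the integers it avoids nested
  \<open>mod\<close> terms later on.\<close>

lemma shift_eq_iff:
  assumes "l > 0" "1 \<le> i" "1 \<le> i'"
  shows "shift l k i = i' \<longleftrightarrow> (i - 1) div l = (i' - 1) div l \<and> int l dvd int i + k - int i'"
proof -
  have "i' = shift l k i \<longleftrightarrow> i' - 1 = shift l k i - 1"
    using assms shift_ge_1[of l k i] by linarith
  also have "\<dots> \<longleftrightarrow> (i' - 1) div l = (shift l k i - 1) div l \<and> (i' - 1) mod l = (shift l k i - 1) mod l"
    by (metis div_mult_mod_eq)
  also have "(i' - 1) mod l = (shift l k i - 1) mod l \<longleftrightarrow>
      int (i' - 1) mod int l = int (shift l k i - 1) mod int l"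
    by (metis of_nat_eq_iff zmod_int)
  also have "\<dots> \<longleftrightarrow> (int (i - 1) + k) mod int l = int (i' - 1) mod int l"
    unfolding shift_cong[OF assms(1)] by auto
  also have "\<dots> \<longleftrightarrow> int l dvd int i + k - int i'"
    using assms by (simp add: mod_eq_dvd_iff of_nat_diff algebra_simps)
  finally show ?thesis
    by (metis shift_block[OF assms(1)])
qed

lemma shift_0:
  assumes "l > 0" "1 \<le> i" shows "shift l 0 i = i"
  using assms by (simp add: shift_eq_iff)

lemma shift_shift:
  assumes "l > 0"
  shows "shift l k (shift l k' i) = shift l (k + k') i"
proof -
  have "(int (shift l k' i - 1) + k) mod int l = (int (i - 1) + (k + k')) mod int l"
    using shift_cong[OF assms, of k' i] by (metis add.assoc add.commute mod_add_cong)
  then show ?thesis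
    unfolding shift_def[of l k] shift_def[of l "k + k'"] shift_block[OF assms] by simp
qed

lemma class_base_ge_1 [simp]: "Suc 0 \<le> class_base l g i" "0 < class_base l g i"
  by (simp_all add: class_base_def)

lemma class_base_offset:
  assumes "g dvd l" "1 \<le> i"
  shows "class_base l g i + g * class_offset l g i = i"
proof -
  have "(i - 1) mod g = (i - 1) mod l mod g"
    using assms by (simp add: mod_mod_cancel)
  then have "(i - 1) mod g + g * class_offset l g i = (i - 1) mod l"
    unfolding class_offset_def by simp
  then show ?thesis
    using assms(2) unfolding class_base_def
    by (metis (no_types, lifting) add.assoc add.commute add_diff_inverse_nat mult_div_mod_eq not_less)
qed

lemma class_base_le:
  assumes "g dvd l" "1 \<le> i" shows "class_base l g i \<le> i"
  using class_base_offset[OF assms] by linarith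

lemma class_offset_less:
  assumes "l = g * \<gamma>" "l > 0"
  shows "class_offset l g i < \<gamma>"
proof -
  have "(i - 1) mod l < \<gamma> * g" using assms by (simp add: mult.commute)
  then show ?thesis
    unfolding class_offset_def by (rule less_mult_imp_div_less)
qed

text \<open>With r = (i - 1) mod g < g and s < \<gamma> the sum r + g s stays below l = g \<gamma>.
  Hence moving s steps down the class never leaves the group, and group, base and offset can be read
  off from the decomposition.\<close>

lemma class_row_arith:
  assumes "l = g * \<gamma>" "l > 0" "s < \<gamma>"
  shows "(class_base l g i + g * s - 1) div l = (i - 1) div l"
    and "class_base l g (class_base l g i + g * s) = class_base l g i"
    and "class_offset l g (class_base l g i + g * s) = s"
proof -
  have g: "g > 0" using assms by (cases g) auto
  define r where "r = (i - 1) mod g"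
  have r: "r < g" unfolding r_def using g by simp
  have rs: "r + g * s < l"
  proof -
    have "r + g * s < g * Suc s" using r by simp
    also have "\<dots> \<le> g * \<gamma>" using assms(3) by (intro mult_le_mono2) simp
    finally show ?thesis using assms(1) by simp
  qed
  have eq: "class_base l g i + g * s - 1 = l * ((i - 1) div l) + (r + g * s)"
    unfolding class_base_def r_def by simp
  show 1: "(class_base l g i + g * s - 1) div l = (i - 1) div l"
    unfolding eq using rs assms(2) by simp
  have "(class_base l g i + g * s - 1) mod g = r"
  proof -
    have "l * ((i - 1) div l) + (r + g * s) = r + g * (\<gamma> * ((i - 1) div l) + s)"
      using assms(1) by (simp add: algebra_simps)
    then show ?thesis unfolding eq using r by (metis mod_less mod_mult_self2)
  qed
  then show "class_base l g (class_base l g i + g * s) = class_base l g i"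
    unfolding class_base_def[of l g "class_base l g i + g * s"] 1
    by (simp add: class_base_def r_def)
  show "class_offset l g (class_base l g i + g * s) = s"
    unfolding class_offset_def eq using rs r g by simp
qed

lemma class_base_eq_iff:
  assumes "g dvd l" "l > 0" "1 \<le> i" "1 \<le> i'"
  shows "class_base l g i = class_base l g i' \<longleftrightarrow>
    (i - 1) div l = (i' - 1) div l \<and> int g dvd int i - int i'"
proof -
  obtain \<gamma> where \<gamma>: "l = g * \<gamma>" using assms(1) by blast
  then have \<gamma>0: "0 < \<gamma>" using assms by (cases \<gamma>) auto
  have "(i - 1) mod g = (i' - 1) mod g \<longleftrightarrow> int (i - 1) mod int g = int (i' - 1) mod int g"
    by (metis of_nat_eq_iff zmod_int)
  also have "\<dots> \<longleftrightarrow> int g dvd int i - int i'"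
    using assms by (simp add: mod_eq_dvd_iff of_nat_diff)
  finally have m: "(i - 1) mod g = (i' - 1) mod g \<longleftrightarrow> int g dvd int i - int i'" .
  have d: "(class_base l g k - 1) div l = (k - 1) div l" for k
    using class_row_arith(1)[OF \<gamma> assms(2) \<gamma>0, of k] by simp
  have "class_base l g i = class_base l g i' \<longleftrightarrow>
     (i - 1) div l = (i' - 1) div l \<and> (i - 1) mod g = (i' - 1) mod g"
  proof
    assume e: "class_base l g i = class_base l g i'"
    then have "(i - 1) div l = (i' - 1) div l" by (metis d)
    with e show "(i - 1) div l = (i' - 1) div l \<and> (i - 1) mod g = (i' - 1) mod g"
      by (simp add: class_base_def)
  qed (simp add: class_base_def)
  then show ?thesis using m by simp
qed

text \<open>Euclid's lemma after cancelling the gcd. It is the source of \<gamma> in both of its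
  roles: the order of the j-th power of the rotation, and the period with which a cycle returns to a
  row.\<close>

lemma dvd_mult_iff_div_gcd_dvd:
  fixes l :: nat and j d :: int
  assumes "l > 0"
  shows "int l dvd j * d \<longleftrightarrow> int (l div gcd l (nat \<bar>j\<bar>)) dvd d"
proof -
  let ?g = "gcd (int l) j"
  have g: "?g > 0" using assms by simp
  have e: "int (l div gcd l (nat \<bar>j\<bar>)) = int l div ?g"
    by (simp add: zdiv_int)
  obtain l' where l': "int l = ?g * l'" using gcd_dvd1 by (rule dvdE)
  obtain j' where j': "j = ?g * j'" using gcd_dvd2 by (rule dvdE)
  note lj = l' j'
  have l'_eq: "l' = int l div ?g" and j'_eq: "j' = j div ?g"
    using g by (metis lj(1) nonzero_mult_div_cancel_left order_less_irrefl,
      metis lj(2) nonzero_mult_div_cancel_left order_less_irrefl)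
  have c: "coprime l' j'"
    unfolding l'_eq j'_eq using assms by (intro div_gcd_coprime) simp
  have "j * d = ?g * (j' * d)" using lj(2) by (metis mult.assoc)
  then have "int l dvd j * d \<longleftrightarrow> ?g * l' dvd ?g * (j' * d)"
    using lj(1) by metis
  also have "\<dots> \<longleftrightarrow> l' dvd j' * d" using g by (metis dvd_mult_cancel_left order_less_irrefl)
  also have "\<dots> \<longleftrightarrow> l' dvd d" using c by (simp add: coprime_dvd_mult_right_iff)
  finally show ?thesis using e l'_eq by metis
qed

text \<open>Multiples of j agree modulo l with multiples of g, so every reachable row is congruent
  to i modulo g; conversely Bezout's identity writes g as a multiple of j modulo l.\<close>

lemma ex_shift_eq_iff:
  fixes j :: int
  assumes "l > 0" "1 \<le> i" "1 \<le> i'" and g: "g = gcd l (nat \<bar>j\<bar>)"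
  shows "(\<exists>e::nat. shift l (- (j * int e)) i = i') \<longleftrightarrow> class_base l g i = class_base l g i'"
proof -
  have gi: "int g = gcd (int l) j" using g by simp
  have "(\<exists>e::nat. int l dvd int i - j * int e - int i') \<longleftrightarrow> int g dvd int i - int i'"
  proof
    assume "\<exists>e::nat. int l dvd int i - j * int e - int i'"
    then obtain e :: nat where "int l dvd int i - j * int e - int i'" by blast
    then have "int g dvd int i - j * int e - int i'" unfolding gi by (meson dvd_trans gcd_dvd1)
    moreover have "int g dvd j * int e" unfolding gi by simp
    ultimately have "int g dvd (int i - j * int e - int i') + j * int e" by (rule dvd_add)
    then show "int g dvd int i - int i'" by simp
  next
    assume "int g dvd int i - int i'"
    then obtain d where d: "int i - int i' = int g * d" by blast
    obtain u v where uv: "u * int l + v * j = int g" unfolding gi using bezout_int by blast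
    \<comment> \<open>Modulo l, Bezout gives v j = g, so j (v d) = g d = i - i'. Reducing v d modulo
      l makes the exponent a natural number.\<close>
    define e where "e = nat ((v * d) mod int l)"
    have "int e = (v * d) mod int l" unfolding e_def using assms by simp
    then have "int l dvd v * d - int e" by (simp add: dvd_minus_mod)
    then have "int l dvd j * (v * d - int e) + int l * (u * d)" by simp
    also have "j * (v * d - int e) + int l * (u * d) = (u * int l + v * j) * d - j * int e"
      by (simp add: algebra_simps)
    also have "\<dots> = int i - j * int e - int i'" unfolding uv using d by simp
    finally show "\<exists>e::nat. int l dvd int i - j * int e - int i'" by blast
  qed
  moreover have "g dvd l" unfolding g by (rule gcd_dvd1)
  ultimately show ?thesis
    using assms by (simp add: shift_eq_iff class_base_eq_iff)
qed

lemma card_residue_class: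
  fixes N \<gamma> r :: nat
  assumes "r < \<gamma>"
  shows "card {e. e < N * \<gamma> \<and> e mod \<gamma> = r} = N"
proof -
  have "{e. e < N * \<gamma> \<and> e mod \<gamma> = r} = (\<lambda>t. t * \<gamma> + r) ` {..<N}"
  proof (intro equalityI subsetI)
    fix e assume "e \<in> {e. e < N * \<gamma> \<and> e mod \<gamma> = r}"
    then show "e \<in> (\<lambda>t. t * \<gamma> + r) ` {..<N}"
      by (intro image_eqI[of _ _ "e div \<gamma>"]) (auto simp: less_mult_imp_div_less)
  next
    fix e assume "e \<in> (\<lambda>t. t * \<gamma> + r) ` {..<N}"
    then obtain t where t: "e = t * \<gamma> + r" "t < N" by blast
    have "e < Suc t * \<gamma>" using t assms by simp
    also have "\<dots> \<le> N * \<gamma>" using t(2) by (intro mult_le_mono1) simp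
    finally show "e \<in> {e. e < N * \<gamma> \<and> e mod \<gamma> = r}" using t assms by simp
  qed
  moreover have "inj_on (\<lambda>t. t * \<gamma> + r) {..<N}" using assms by (auto simp: inj_on_def)
  ultimately show ?thesis by (simp add: card_image)
qed

text \<open>If i' is reached at all, the exponents reaching it form one residue class modulo l / g,
  and a range whose length N is a multiple of l / g contains N / (l / g) of them.\<close>

lemma card_shift_eq:
  fixes j :: int
  assumes "l > 0" "1 \<le> i" "1 \<le> i'" and g: "g = gcd l (nat \<bar>j\<bar>)" and "l div g dvd N"
  shows "card {e. e < N \<and> shift l (- (j * int e)) i = i'} =
    (if class_base l g i = class_base l g i' then N div (l div g) else 0)"
proof (cases "class_base l g i = class_base l g i'")
  case True
  then obtain e0 where e0: "shift l (- (j * int e0)) i = i'"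
    using ex_shift_eq_iff[OF assms(1-3) g] by blast
  let ?\<gamma> = "l div g"
  have "g dvd l" unfolding g by (rule gcd_dvd1)
  then have \<gamma>: "?\<gamma> > 0" using assms(1) by (metis dvd_div_eq_0_iff neq0_conv)
  have b: "(i - 1) div l = (i' - 1) div l" and d0: "int l dvd int i - j * int e0 - int i'"
    using e0 assms by (simp_all add: shift_eq_iff)
  have iff: "shift l (- (j * int e)) i = i' \<longleftrightarrow> e mod ?\<gamma> = e0 mod ?\<gamma>" for e
  proof -
    have "shift l (- (j * int e)) i = i' \<longleftrightarrow> int l dvd int i - j * int e - int i'"
      using assms b by (simp add: shift_eq_iff)
    also have "int i - j * int e - int i' = (int i - j * int e0 - int i') + j * (int e0 - int e)"
      by (simp add: algebra_simps)
    also have "int l dvd \<dots> \<longleftrightarrow> int l dvd j * (int e0 - int e)"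
      using d0 by (rule dvd_add_right_iff)
    also have "\<dots> \<longleftrightarrow> int ?\<gamma> dvd int e0 - int e"
      unfolding g by (rule dvd_mult_iff_div_gcd_dvd[OF assms(1)])
    also have "\<dots> \<longleftrightarrow> int e0 mod int ?\<gamma> = int e mod int ?\<gamma>" by (simp only: mod_eq_dvd_iff)
    also have "\<dots> \<longleftrightarrow> e mod ?\<gamma> = e0 mod ?\<gamma>" by (metis of_nat_eq_iff zmod_int)
    finally show ?thesis .
  qed
  obtain M where M: "N = M * ?\<gamma>" using assms(5) by (metis dvdE mult.commute)
  show ?thesis
    unfolding iff using card_residue_class[of "e0 mod ?\<gamma>" ?\<gamma> M] \<gamma> True M by simp
next
  case False
  then have "shift l (- (j * int e)) i \<noteq> i'" for e
    using ex_shift_eq_iff[OF assms(1-3) g] by blast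
  then show ?thesis using False by simp
qed

section \<open>The permutations as rotations of rows\<close>

text \<open>It regroups the flat product of cycles by component and by group of rows, so that
  disjointness can be applied at each level separately.\<close>

lemma foldr_comp_concat:
  "foldr (\<circ>) (concat xss) id = foldr (\<circ>) (map (\<lambda>xs. foldr (\<circ>) xs id) xss) id"
proof (induction xss)
  case (Cons xs xss)
  have comp: "foldr (\<circ>) xs g = foldr (\<circ>) xs id \<circ> g" for g :: "'a \<Rightarrow> 'a"
    by (induction xs) (auto simp: comp_assoc)
  have "foldr (\<circ>) (concat (xs # xss)) id = foldr (\<circ>) xs (foldr (\<circ>) (concat xss) id)" by simp
  also have "\<dots> = foldr (\<circ>) xs id \<circ> foldr (\<circ>) (map (\<lambda>xs. foldr (\<circ>) xs id) xss) id"
    unfolding Cons.IH by (rule comp)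
  also have "\<dots> = foldr (\<circ>) (map (\<lambda>xs. foldr (\<circ>) xs id) (xs # xss)) id" by simp
  finally show ?case .
qed simp

text \<open>Every factor fixes the supports of the others pointwise, so on \<open>S k\<close> the
  product acts as \<open>f k\<close> alone. It is applied to the columns of a group, to the groups
  of a diagram and to the components of the tuple.\<close>

lemma foldr_comp_disjoint:
  assumes "distinct ks" "\<And>k. k \<in> set ks \<Longrightarrow> f k permutes S k"
    and "\<And>k k'. k \<in> set ks \<Longrightarrow> k' \<in> set ks \<Longrightarrow> k \<noteq> k' \<Longrightarrow> S k \<inter> S k' = {}"
  shows "foldr (\<circ>) (map f ks) id permutes (\<Union>k\<in>set ks. S k) \<and>
    (\<forall>k\<in>set ks. \<forall>x\<in>S k. foldr (\<circ>) (map f ks) id x = f k x)"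
  using assms
proof (induction ks)
  case Nil
  then show ?case by (simp add: permutes_id[unfolded id_def] id_def)
next
  case (Cons k ks)
  let ?F = "foldr (\<circ>) (map f ks) id"
  have IH: "?F permutes (\<Union>k\<in>set ks. S k)" "\<And>k' x. k' \<in> set ks \<Longrightarrow> x \<in> S k' \<Longrightarrow> ?F x = f k' x"
  proof -
    have "?F permutes (\<Union>k\<in>set ks. S k) \<and> (\<forall>k\<in>set ks. \<forall>x\<in>S k. ?F x = f k x)"
      by (rule Cons.IH) (use Cons.prems in auto)
    then show "?F permutes (\<Union>k\<in>set ks. S k)" "\<And>k' x. k' \<in> set ks \<Longrightarrow> x \<in> S k' \<Longrightarrow> ?F x = f k' x"
      by blast+
  qed
  have fk: "f k permutes S k" using Cons.prems by simp
  have "f k \<circ> ?F permutes (\<Union>k\<in>set (k # ks). S k)"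
    by (intro permutes_compose permutes_subset[OF IH(1)] permutes_subset[OF fk]) auto
  moreover have "(f k \<circ> ?F) x = f k' x" if k': "k' \<in> set (k # ks)" and x: "x \<in> S k'" for k' x
  proof (cases "k' = k")
    case True
    have "S k \<inter> S k'' = {}" if "k'' \<in> set ks" for k''
      using Cons.prems(1) Cons.prems(3)[of k k''] that by force
    then have "x \<notin> (\<Union>k\<in>set ks. S k)" using x True by blast
    then show ?thesis using permutes_not_in[OF IH(1)] True by simp
  next
    case False
    then have "k' \<in> set ks" using k' by simp
    moreover from this have "f k' x \<in> S k'"
      using Cons.prems(2)[of k'] x by (simp add: permutes_in_image)
    \<comment> \<open>The inner factor keeps the point inside \<open>S k'\<close>, hence outside the
      support of the outer factor \<open>f k\<close>.\<close>
    ultimately have "f k' x \<notin> S k" using Cons.prems(3)[of k k'] False by auto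
    then show ?thesis using permutes_not_in[OF fk] IH(2) \<open>k' \<in> set ks\<close> x by simp
  qed
  moreover have "foldr (\<circ>) (map f (k # ks)) id = f k \<circ> ?F" by simp
  ultimately show ?case by metis
qed

lemma cycle_of_list_map_upt:
  assumes "inj_on t {1..l}" "1 \<le> s" "s \<le> l"
  shows "cycle_of_list (map t [1..<l + 1]) (t s) = t (if s = l then 1 else s + 1)"
proof -
  let ?cs = "map t [1..<l + 1]"
  have "{1..<l + 1} = {1..l}" by auto
  then have "cycle ?cs" using assms(1) by (auto simp: distinct_map simp del: upt_Suc)
  from cyclic_rotation[OF this, of 1] have eq: "map (cycle_of_list ?cs) ?cs = rotate1 ?cs"
    by (simp del: upt_Suc)
  have "?cs ! (s - 1) = t s" using assms by (simp del: upt_Suc)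
  then have "cycle_of_list ?cs (t s) = map (cycle_of_list ?cs) ?cs ! (s - 1)"
    using assms by (simp del: upt_Suc)
  also have "\<dots> = ?cs ! (Suc (s - 1) mod l)"
    unfolding eq using assms by (subst nth_rotate1) (simp_all del: upt_Suc)
  also have "\<dots> = t (if s = l then 1 else s + 1)"
    using assms by (auto simp del: upt_Suc)
  finally show ?thesis .
qed

text \<open>Each new index fills the interval following those already used. The lemma serves at two
  levels: row lengths within a diagram, and component sizes within the tuple.\<close>

lemma sum_prefix_bij:
  fixes f :: "nat \<Rightarrow> nat"
  shows "bij_betw (\<lambda>(i, j). (\<Sum>r\<in>{1..<i}. f r) + j)
    {(i, j). 1 \<le> i \<and> i \<le> N \<and> 1 \<le> j \<and> j \<le> f i} {1..\<Sum>r\<in>{1..N}. f r}"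
proof (induction N)
  case 0
  show ?case by (auto simp: bij_betw_def inj_on_def)
next
  case (Suc N)
  let ?s = "\<Sum>r\<in>{1..N}. f r"
  have e: "(\<Sum>r\<in>{1..<Suc N}. f r) = ?s" by (rule sum.cong) auto
  have "bij_betw (\<lambda>(i, j). ?s + j) ({Suc N} \<times> {1..f (Suc N)}) {?s + 1..?s + f (Suc N)}"
    by (rule bij_betwI[where g = "\<lambda>x. (Suc N, x - ?s)"]) auto
  then have "bij_betw (\<lambda>(i, j). (\<Sum>r\<in>{1..<i}. f r) + j) ({Suc N} \<times> {1..f (Suc N)})
    {?s + 1..?s + f (Suc N)}"
    by (subst bij_betw_cong[where g = "\<lambda>(i, j). ?s + j"]) (use e in auto)
  from bij_betw_combine[OF Suc.IH this]
  have "bij_betw (\<lambda>(i, j). (\<Sum>r\<in>{1..<i}. f r) + j)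
    ({(i, j). 1 \<le> i \<and> i \<le> N \<and> 1 \<le> j \<and> j \<le> f i} \<union> {Suc N} \<times> {1..f (Suc N)})
    ({1..?s} \<union> {?s + 1..?s + f (Suc N)})" by auto
  moreover have "{(i, j). 1 \<le> i \<and> i \<le> N \<and> 1 \<le> j \<and> j \<le> f i} \<union> {Suc N} \<times> {1..f (Suc N)}
    = {(i, j). 1 \<le> i \<and> i \<le> Suc N \<and> 1 \<le> j \<and> j \<le> f i}" by (auto simp: le_Suc_eq)
  moreover have "{1..?s} \<union> {?s + 1..?s + f (Suc N)} = {1..\<Sum>r\<in>{1..Suc N}. f r}"
    by auto
  ultimately show ?case by simp
qed

section \<open>Diagrams, their standard numbering and the row lengths of l-partitions\<close>

definition diagram :: "nat list \<Rightarrow> (nat \<times> nat) set" where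
  "diagram \<mu> = {(i, j). 1 \<le> i \<and> 1 \<le> j \<and> j \<le> part \<mu> i}"

lemma part_pos_iff:
  assumes "partition_of \<mu> m"
  shows "0 < part \<mu> i \<longleftrightarrow> 1 \<le> i \<and> i \<le> length \<mu>"
  using assms by (auto simp: partition_of_def part_def)

lemma diagram_altdef:
  "diagram \<mu> = {(i, j). 1 \<le> i \<and> i \<le> length \<mu> \<and> 1 \<le> j \<and> j \<le> part \<mu> i}"
  by (auto simp: diagram_def part_def split: if_splits)

lemma sum_part: "(\<Sum>r\<in>{1..length \<mu>}. part \<mu> r) = sum_list \<mu>"
proof -
  have "(\<Sum>r\<in>{1..length \<mu>}. part \<mu> r) = (\<Sum>r\<in>{0..<length \<mu>}. part \<mu> (Suc r))"
    by (rule sum.reindex_bij_witness[of _ Suc "\<lambda>r. r - 1"]) auto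
  also have "\<dots> = sum_list \<mu>" by (simp add: part_def sum_list_sum_nth)
  finally show ?thesis .
qed

lemma std_num1_bij: "bij_betw (std_num1 \<mu>) (diagram \<mu>) {1..sum_list \<mu>}"
  using sum_prefix_bij[of "part \<mu>" "length \<mu>"]
  unfolding std_num1_def diagram_altdef sum_part .

text \<open>For \<open>v > 0\<close>, the rows of length at least \<open>v\<close> are the first \<open>N\<close> ones, where \<open>N\<close> is the sum
  of the multiplicities of the parts at least \<open>v\<close> and hence divisible by \<open>l\<close>.\<close>

lemma l_partition_part_block:
  assumes lp: "l_partition_of l \<mu> m" and l: "l > 0"
    and i: "1 \<le> i" "1 \<le> i'" "(i - 1) div l = (i' - 1) div l"
  shows "part \<mu> i = part \<mu> i'"
proof -
  define N where "N v = length (filter (\<lambda>x. v \<le> x) \<mu>)" for v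
  have srt: "sorted_wrt (\<ge>) \<mu>" using lp by (simp add: l_partition_of_def partition_of_def)
  have len: "v \<le> part \<mu> i \<longleftrightarrow> i \<le> N v" if "v > 0" "1 \<le> i" for v i
    unfolding N_def using srt that(2)
  proof (induction \<mu> arbitrary: i)
    case Nil
    then show ?case using \<open>v > 0\<close> by (simp add: part_def)
  next
    case (Cons x xs)
    show ?case
    proof (cases "v \<le> x")
      case True
      show ?thesis
      proof (cases "i = 1")
        case False
        then have "1 \<le> i - 1" using Cons.prems by simp
        moreover have "part (x # xs) i = part xs (i - 1)"
          using False Cons.prems by (auto simp: part_def nth_Cons')
        ultimately show ?thesis using Cons.IH[of "i - 1"] Cons.prems True by auto
      qed (use True in \<open>simp add: part_def\<close>)
    next
      case False
      then have "\<forall>y\<in>set (x # xs). \<not> v \<le> y" using Cons.prems by auto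
      moreover have "part (x # xs) i = 0 \<or> part (x # xs) i \<in> set (x # xs)"
        unfolding part_def using nth_mem[of "i - 1" "x # xs"] by auto
      ultimately have "filter (\<lambda>x. v \<le> x) (x # xs) = []" "\<not> v \<le> part (x # xs) i"
        using \<open>v > 0\<close> by (auto simp: filter_empty_conv)
      then show ?thesis using Cons.prems by simp
    qed
  qed
  have dvd: "l dvd N v" for v
  proof -
    have "N v = (\<Sum>u\<in>set (filter (\<lambda>x. v \<le> x) \<mu>). count_list (filter (\<lambda>x. v \<le> x) \<mu>) u)"
      unfolding N_def by (simp only: sum_count_set[OF order_refl finite_set])
    also have "\<dots> = (\<Sum>u\<in>set (filter (\<lambda>x. v \<le> x) \<mu>). count_list \<mu> u)"
    proof (rule sum.cong[OF refl])
      fix u assume "u \<in> set (filter (\<lambda>x. v \<le> x) \<mu>)"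
      then have "v \<le> u" by simp
      then show "count_list (filter (\<lambda>x. v \<le> x) \<mu>) u = count_list \<mu> u"
        by (induction \<mu>) auto
    qed
    finally show ?thesis using lp by (simp add: l_partition_of_def dvd_sum)
  qed
  have iff: "i \<le> N v \<longleftrightarrow> i' \<le> N v" for v
  proof -
    obtain c where c: "N v = c * l" using dvd[of v] by (metis dvdE mult.commute)
    \<comment> \<open>A threshold at a multiple of l never cuts through a group of l rows.\<close>
    have "k \<le> c * l \<longleftrightarrow> (k - 1) div l < c" if "1 \<le> k" for k
      using that l by (auto simp: div_less_iff_less_mult)
    then show ?thesis using i c by simp
  qed
  have "v \<le> part \<mu> i \<longleftrightarrow> v \<le> part \<mu> i'" for v
    by (cases "v = 0") (use len i iff in auto)
  then show ?thesis by (meson order_antisym order_refl)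
qed

text \<open>The supports of the cycles are the parts of columns inside one group of rows; they are
  collected into the sets \<open>S q\<close>, one for each group. The numbering \<open>t\<close> is
  any injection, so that the lemma covers both \<open>std_num1\<close> and the restriction of
  \<open>std_num\<close> to one component.\<close>

lemma column_cycles_action:
  assumes l: "l > 0" and inj: "inj_on t (diagram \<mu>)"
    and lp: "l_partition_of l \<mu> m"
  shows "foldr (\<circ>) (column_cycles l \<mu> t) id permutes t ` diagram \<mu>"
    and "\<And>i j. (i, j) \<in> diagram \<mu> \<Longrightarrow>
      foldr (\<circ>) (column_cycles l \<mu> t) id (t (i, j)) = t (shift l 1 i, j)"
proof -
  note blk = l_partition_part_block[OF lp l]
  define c where "c q j = cycle_of_list (map (\<lambda>s. t (l * q + s, j)) [1..<l + 1])" for q j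
  define f where "f q = foldr (\<circ>) (map (c q) [1..<part \<mu> (l * q + 1) + 1]) id" for q
  define S where "S q = {l * q + 1..l * q + l} \<times> {1..part \<mu> (l * q + 1)}" for q
  have q_div: "(i - 1) div l = q" if "l * q + 1 \<le> i" "i \<le> l * q + l" for i q
    using that l by (intro div_nat_eqI) (auto simp: algebra_simps)
  have S_sub: "S q \<subseteq> diagram \<mu>" for q
  proof
    fix x assume "x \<in> S q"
    then obtain i j where x: "x = (i, j)" "l * q + 1 \<le> i" "i \<le> l * q + l" "1 \<le> j" "j \<le> part \<mu> (l * q + 1)"
      unfolding S_def by auto
    \<comment> \<open>The cycles are indexed by the columns of the first row of the group; equal row
      lengths make each of these columns a full column of l boxes.\<close>
    have "part \<mu> i = part \<mu> (l * q + 1)"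
      using x q_div[of q i] q_div[of q "l * q + 1"] l by (intro blk) auto
    then show "x \<in> diagram \<mu>" using x by (auto simp: diagram_def)
  qed
  have in_S: "(i, j) \<in> S q" "q < length \<mu>" if "(i, j) \<in> diagram \<mu>" "q = (i - 1) div l" for i j q
  proof -
    have i: "1 \<le> i" "i \<le> length \<mu>" "1 \<le> j" "j \<le> part \<mu> i" using that(1) by (auto simp: diagram_altdef)
    have e: "i - 1 = l * q + (i - 1) mod l" using that(2) by simp
    have m: "(i - 1) mod l < l" using l by simp
    have b: "l * q + 1 \<le> i" "i \<le> l * q + l" using e m i by linarith+
    have "part \<mu> i = part \<mu> (l * q + 1)"
      using i l that(2) by (intro blk) auto
    then show "(i, j) \<in> S q" unfolding S_def using i b by auto
    \<comment> \<open>There are at most \<open>length \<mu>\<close> groups, so the range of q in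
      \<open>column_cycles\<close> reaches all of them.\<close>
    have "q \<le> i - 1" unfolding that(2) by (rule div_le_dividend)
    then show "q < length \<mu>" using i by linarith
  qed
  have col: "{l * q + 1..l * q + l} \<times> {j} \<subseteq> S q" if "j \<in> {1..part \<mu> (l * q + 1)}" for q j
    using that unfolding S_def by auto
  have c_perm: "c q j permutes t ` ({l * q + 1..l * q + l} \<times> {j})"
    and c_act: "\<And>i. l * q + 1 \<le> i \<Longrightarrow> i \<le> l * q + l \<Longrightarrow> c q j (t (i, j)) = t (shift l 1 i, j)"
    if "j \<in> {1..part \<mu> (l * q + 1)}" for q j
  proof -
    have "(\<lambda>s. t (l * q + s, j)) ` {1..<l + 1} = t ` ({l * q + 1..l * q + l} \<times> {j})"
    proof -
      have "(\<lambda>s. (l * q + s, j)) ` {1..<l + 1} = {l * q + 1..l * q + l} \<times> {j}"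
      proof (intro equalityI subsetI)
        fix x assume "x \<in> {l * q + 1..l * q + l} \<times> {j}"
        then show "x \<in> (\<lambda>s. (l * q + s, j)) ` {1..<l + 1}"
          by (intro image_eqI[of _ _ "fst x - l * q"]) auto
      qed auto
      then show ?thesis by (metis image_image)
    qed
    then show "c q j permutes t ` ({l * q + 1..l * q + l} \<times> {j})"
      unfolding c_def using cycle_permutes[of "map (\<lambda>s. t (l * q + s, j)) [1..<l + 1]"]
      by (simp del: upt_Suc)
    have inj': "inj_on (\<lambda>s. t (l * q + s, j)) {1..l}"
    proof (rule inj_onI)
      fix s s' assume s: "s \<in> {1..l}" "s' \<in> {1..l}" and eq: "t (l * q + s, j) = t (l * q + s', j)"
      have "(l * q + s, j) \<in> diagram \<mu>" "(l * q + s', j) \<in> diagram \<mu>"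
        using s by (intro subsetD[OF subset_trans[OF col[OF that] S_sub]]; simp)+
      then show "s = s'" using inj eq by (auto dest: inj_onD)
    qed
    fix i assume i: "l * q + 1 \<le> i" "i \<le> l * q + l"
    define s where "s = i - l * q"
    have s: "1 \<le> s" "s \<le> l" "i = l * q + s" using i by (auto simp: s_def)
    have "c q j (t (i, j)) = t (l * q + (if s = l then 1 else s + 1), j)"
      unfolding c_def s(3) using cycle_of_list_map_upt[OF inj' s(1,2)] by simp
    \<comment> \<open>The wrap-around of the cycle from the last to the first row of the group is
      the reduction modulo l inside \<open>shift\<close>.\<close>
    also have "l * q + (if s = l then 1 else s + 1) = shift l 1 i"
      by (rule sym, subst shift_eq_iff[OF l])
        (use s q_div[of q i] q_div[of q "l * q + (if s = l then 1 else s + 1)"] in \<open>auto\<close>)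
    finally show "c q j (t (i, j)) = t (shift l 1 i, j)" .
  qed
  have f_perm: "f q permutes t ` S q"
    and f_act: "\<And>i j. (i, j) \<in> S q \<Longrightarrow> f q (t (i, j)) = t (shift l 1 i, j)" for q
  proof -
    have set: "set [1..<part \<mu> (l * q + 1) + 1] = {1..part \<mu> (l * q + 1)}" by auto
    have "foldr (\<circ>) (map (c q) [1..<part \<mu> (l * q + 1) + 1]) id permutes
         (\<Union>j\<in>set [1..<part \<mu> (l * q + 1) + 1]. t ` ({l * q + 1..l * q + l} \<times> {j})) \<and>
      (\<forall>j\<in>set [1..<part \<mu> (l * q + 1) + 1]. \<forall>x\<in>t ` ({l * q + 1..l * q + l} \<times> {j}).
         foldr (\<circ>) (map (c q) [1..<part \<mu> (l * q + 1) + 1]) id x = c q j x)"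
    proof (rule foldr_comp_disjoint)
      fix j j' assume jj: "j \<in> set [1..<part \<mu> (l * q + 1) + 1]" "j' \<in> set [1..<part \<mu> (l * q + 1) + 1]" "j \<noteq> j'"
      have "t ` ({l * q + 1..l * q + l} \<times> {j}) \<inter> t ` ({l * q + 1..l * q + l} \<times> {j'}) =
        t ` (({l * q + 1..l * q + l} \<times> {j}) \<inter> ({l * q + 1..l * q + l} \<times> {j'}))"
        using jj(1,2) col S_sub unfolding set by (intro inj_on_image_Int[OF inj, symmetric]) blast+
      then show "t ` ({l * q + 1..l * q + l} \<times> {j}) \<inter> t ` ({l * q + 1..l * q + l} \<times> {j'}) = {}"
        using jj(3) by auto
    qed (use c_perm set in auto)
    note this[unfolded set, folded f_def]
    then have p: "f q permutes (\<Union>j\<in>{1..part \<mu> (l * q + 1)}. t ` ({l * q + 1..l * q + l} \<times> {j}))"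
      and a: "\<And>j i. j \<in> {1..part \<mu> (l * q + 1)} \<Longrightarrow> i \<in> {l * q + 1..l * q + l} \<Longrightarrow>
        f q (t (i, j)) = c q j (t (i, j))"
      by auto
    have "(\<Union>j\<in>{1..part \<mu> (l * q + 1)}. t ` ({l * q + 1..l * q + l} \<times> {j})) = t ` S q"
      unfolding S_def by auto
    with p show "f q permutes t ` S q" by simp
    fix i j assume "(i, j) \<in> S q"
    then show "f q (t (i, j)) = t (shift l 1 i, j)"
      unfolding S_def using a[of j i] c_act[of j q i] by auto
  qed
  have F: "foldr (\<circ>) (column_cycles l \<mu> t) id = foldr (\<circ>) (map f [0..<length \<mu>]) id"
    unfolding column_cycles_def foldr_comp_concat f_def c_def by (simp add: comp_def)
  have main: "foldr (\<circ>) (map f [0..<length \<mu>]) id permutes (\<Union>q\<in>set [0..<length \<mu>]. t ` S q) \<and>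
    (\<forall>q\<in>set [0..<length \<mu>]. \<forall>x\<in>t ` S q. foldr (\<circ>) (map f [0..<length \<mu>]) id x = f q x)"
  proof (rule foldr_comp_disjoint)
    fix q q' :: nat assume "q \<noteq> q'"
    then have "S q \<inter> S q' = {}" unfolding S_def using q_div[of q] q_div[of q'] by fastforce
    moreover have "t ` S q \<inter> t ` S q' = t ` (S q \<inter> S q')"
      using S_sub by (intro inj_on_image_Int[OF inj, symmetric])
    ultimately show "t ` S q \<inter> t ` S q' = {}" by simp
  qed (use f_perm in auto)
  have "(\<Union>q\<in>set [0..<length \<mu>]. S q) = diagram \<mu>"
    using S_sub in_S by fastforce
  then have "(\<Union>q\<in>set [0..<length \<mu>]. t ` S q) = t ` diagram \<mu>" by (metis image_UN)
  with main F show "foldr (\<circ>) (column_cycles l \<mu> t) id permutes t ` diagram \<mu>" by simp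
  fix i j assume ij: "(i, j) \<in> diagram \<mu>"
  then have "(i, j) \<in> S ((i - 1) div l)" "(i - 1) div l < length \<mu>" using in_S by blast+
  then have "foldr (\<circ>) (column_cycles l \<mu> t) id (t (i, j)) = f ((i - 1) div l) (t (i, j))"
    unfolding F using main by auto
  then show "foldr (\<circ>) (column_cycles l \<mu> t) id (t (i, j)) = t (shift l 1 i, j)"
    using f_act \<open>(i, j) \<in> S ((i - 1) div l)\<close> by metis
qed

text \<open>Here \<open>t\<close> intertwines \<open>a\<close> with \<open>act 1\<close>, and
  natural powers follow by iteration. For k = -e the power is the inverse function of a^e, and a^e
  carries \<open>t (act k b)\<close> back to \<open>t b\<close>.\<close>

lemma sym_group_int_pow_action:
  fixes act :: "int \<Rightarrow> 'b \<Rightarrow> 'b" and k :: int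
  assumes a: "a \<in> carrier (sym_group M)"
    and act_0: "\<And>b. b \<in> B \<Longrightarrow> act 0 b = b"
    and act_add: "\<And>k k' b. b \<in> B \<Longrightarrow> act k (act k' b) = act (k + k') b"
    and act_in: "\<And>k b. b \<in> B \<Longrightarrow> act k b \<in> B"
    and a_act: "\<And>b. b \<in> B \<Longrightarrow> a (t b) = t (act 1 b)"
    and b: "b \<in> B"
  shows "(a [^]\<^bsub>sym_group M\<^esub> k) (t b) = t (act k b)"
proof -
  interpret G: group "sym_group M" by (rule sym_group_is_group)
  have pow: "(a [^]\<^bsub>sym_group M\<^esub> (e::nat)) (t b) = t (act (int e) b)" if "b \<in> B" for e b
    using that
  proof (induction e arbitrary: b)
    case 0
    then show ?case by (simp add: sym_group_one act_0)
  next
    case (Suc e)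
    then show ?case
      using act_in by (simp add: sym_group_mult a_act act_add add.commute)
  qed
  show ?thesis
  proof (cases "k \<ge> 0")
    case True
    then show ?thesis using pow[OF b, of "nat k"]
      by (metis int_pow_int int_nat_eq)
  next
    case False
    define e where "e = nat (- k)"
    have k: "k = - int e" using False e_def by simp
    let ?p = "a [^]\<^bsub>sym_group M\<^esub> e"
    have p: "?p \<in> carrier (sym_group M)" using a by simp
    have "a [^]\<^bsub>sym_group M\<^esub> k = inv' ?p"
      unfolding k using p a by (simp add: G.int_pow_neg int_pow_int)
    moreover have "?p (t (act k b)) = t b"
      using pow[OF act_in[OF b, of k], of e] act_add[OF b] act_0[OF b] by (simp add: k)
    moreover have "bij ?p" using p by (simp add: sym_group_carrier permutes_bij)
    ultimately show ?thesis by (metis bij_inv_eq_iff)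
  qed
qed

section \<open>Rows and boxes of a tuple of diagrams, and the action of the powers of a on
  them\<close>

locale multi_l_partition =
  fixes n :: nat and ms ls :: "nat \<Rightarrow> nat" and \<mu> :: "nat \<Rightarrow> nat list"
  assumes ms_pos: "\<And>h. h \<in> {1..n} \<Longrightarrow> ms h > 0"
    and ls_pos: "\<And>h. h \<in> {1..n} \<Longrightarrow> ls h > 0"
    and multi_partition: "multi_partition_of n ls \<mu> ms"
begin

abbreviation "Bx \<equiv> boxes n \<mu>"
abbreviation "size_m \<equiv> total_size n \<mu>"

definition rows :: "(nat \<times> nat) set" where
  "rows = {(i, h). h \<in> {1..n} \<and> 1 \<le> i \<and> i \<le> length (\<mu> h)}"

definition row_shift :: "int \<Rightarrow> nat \<times> nat \<Rightarrow> nat \<times> nat" where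
  "row_shift k = (\<lambda>(i, h). (shift (ls h) k i, h))"

definition box_shift :: "int \<Rightarrow> box \<Rightarrow> box" where
  "box_shift k = (\<lambda>(i, j, h). (shift (ls h) k i, j, h))"

definition row_of :: "box \<Rightarrow> nat \<times> nat" where
  "row_of = (\<lambda>(i, j, h). (i, h))"

lemma l_partition: "h \<in> {1..n} \<Longrightarrow> l_partition_of (ls h) (\<mu> h) (ms h)"
  using multi_partition by (simp add: multi_partition_of_def)

lemma partition: "h \<in> {1..n} \<Longrightarrow> partition_of (\<mu> h) (ms h)"
  using l_partition by (simp add: l_partition_of_def)

lemma sum_list_eq: "h \<in> {1..n} \<Longrightarrow> sum_list (\<mu> h) = ms h"
  using partition by (simp add: partition_of_def)

lemma total_size_eq: "size_m = (\<Sum>h\<in>{1..n}. ms h)"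
  unfolding total_size_def by (intro sum.cong refl sum_list_eq)

lemma part_block:
  assumes "h \<in> {1..n}" "1 \<le> i" "1 \<le> i'" "(i - 1) div ls h = (i' - 1) div ls h"
  shows "part (\<mu> h) i = part (\<mu> h) i'"
  using l_partition_part_block[OF l_partition[OF assms(1)] ls_pos[OF assms(1)]] assms by blast

lemma part_shift:
  assumes "h \<in> {1..n}" "1 \<le> i"
  shows "part (\<mu> h) (shift (ls h) k i) = part (\<mu> h) i"
  using part_block[OF assms(1), of "shift (ls h) k i" i] shift_block[OF ls_pos[OF assms(1)]] assms
  by simp

lemma boxes_iff:
  "(i, j, h) \<in> Bx \<longleftrightarrow> h \<in> {1..n} \<and> (i, j) \<in> diagram (\<mu> h)"
  by (auto simp: boxes_def diagram_def)

lemma rows_iff: "(i, h) \<in> rows \<longleftrightarrow> h \<in> {1..n} \<and> 1 \<le> i \<and> 0 < part (\<mu> h) i"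
  using part_pos_iff[OF partition] by (auto simp: rows_def)

lemma boxes_iff_rows: "(i, j, h) \<in> Bx \<longleftrightarrow> (i, h) \<in> rows \<and> 1 \<le> j \<and> j \<le> part (\<mu> h) i"
  by (auto simp: boxes_def rows_iff)

lemma row_of_in_rows: "b \<in> Bx \<Longrightarrow> row_of b \<in> rows"
  by (cases b) (auto simp: row_of_def boxes_iff_rows)

lemma row_shift_in_rows: "p \<in> rows \<Longrightarrow> row_shift k p \<in> rows"
  by (cases p) (auto simp: row_shift_def rows_iff part_shift)

lemma row_shift_0: "p \<in> rows \<Longrightarrow> row_shift 0 p = p"
  by (cases p) (auto simp: row_shift_def rows_iff shift_0 ls_pos)

lemma row_shift_add: "p \<in> rows \<Longrightarrow> row_shift k (row_shift k' p) = row_shift (k + k') p"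
  by (cases p) (auto simp: row_shift_def rows_iff shift_shift ls_pos)

lemma box_shift_in: "b \<in> Bx \<Longrightarrow> box_shift k b \<in> Bx"
  by (cases b) (auto simp: box_shift_def boxes_def part_shift)

lemma box_shift_0: "b \<in> Bx \<Longrightarrow> box_shift 0 b = b"
  by (cases b) (auto simp: box_shift_def boxes_def shift_0 ls_pos)

lemma box_shift_add: "b \<in> Bx \<Longrightarrow> box_shift k (box_shift k' b) = box_shift (k + k') b"
  by (cases b) (auto simp: box_shift_def boxes_def shift_shift ls_pos)

lemma row_of_box_shift: "row_of (box_shift k b) = row_shift k (row_of b)"
  by (cases b) (simp add: row_of_def box_shift_def row_shift_def)

text \<open>A box corresponds to its component paired with its number inside that component; the
  prefix sums of the component sizes merge these pairs into one interval.\<close>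

lemma std_num_bij: "bij_betw (std_num n \<mu>) Bx {1..size_m}"
proof -
  let ?f = "\<lambda>(i, j, h). (h, std_num1 (\<mu> h) (i, j))"
  let ?M = "{(h, x). 1 \<le> h \<and> h \<le> n \<and> 1 \<le> x \<and> x \<le> sum_list (\<mu> h)}"
  have inj: "inj_on ?f Bx"
  proof (rule inj_onI)
    fix b b' assume b: "b \<in> Bx" "b' \<in> Bx" and eq: "?f b = ?f b'"
    obtain i j h where bb: "b = (i, j, h)" by (cases b)
    obtain i' j' h' where bb': "b' = (i', j', h')" by (cases b')
    have "h' = h" "std_num1 (\<mu> h) (i, j) = std_num1 (\<mu> h) (i', j')" using eq bb bb' by auto
    moreover have "(i, j) \<in> diagram (\<mu> h)" "(i', j') \<in> diagram (\<mu> h')"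
      using b bb bb' by (auto simp: boxes_iff)
    ultimately show "b = b'" using std_num1_bij[of "\<mu> h"] bb bb' by (auto simp: bij_betw_def dest: inj_onD)
  qed
  have "?f ` Bx = ?M"
  proof (intro equalityI subsetI)
    fix x assume "x \<in> ?f ` Bx"
    then obtain i j h where "(i, j, h) \<in> Bx" "x = (h, std_num1 (\<mu> h) (i, j))" by force
    then show "x \<in> ?M" using bij_betwE[OF std_num1_bij, of "\<mu> h"] by (auto simp: boxes_iff)
  next
    fix y assume "y \<in> ?M"
    then obtain h x where y: "y = (h, x)" "h \<in> {1..n}" "x \<in> {1..sum_list (\<mu> h)}" by auto
    then have "x \<in> std_num1 (\<mu> h) ` diagram (\<mu> h)"
      using std_num1_bij[of "\<mu> h"] by (simp add: bij_betw_def)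
    then obtain i j where "(i, j) \<in> diagram (\<mu> h)" "std_num1 (\<mu> h) (i, j) = x" by auto
    then show "y \<in> ?f ` Bx" using y by (intro image_eqI[of _ _ "(i, j, h)"]) (auto simp: boxes_iff)
  qed
  with inj have "bij_betw ?f Bx ?M" by (simp add: bij_betw_def)
  from bij_betw_trans[OF this sum_prefix_bij]
  have "bij_betw ((\<lambda>(i, j). (\<Sum>r\<in>{1..<i}. sum_list (\<mu> r)) + j) \<circ> ?f) Bx {1..size_m}"
    unfolding total_size_def .
  then show ?thesis
    by (subst bij_betw_cong[where g = "(\<lambda>(i, j). (\<Sum>r\<in>{1..<i}. sum_list (\<mu> r)) + j) \<circ> ?f"])
      (auto simp: std_num_def)
qed

lemma a_perm1_carrier: "h \<in> {1..n} \<Longrightarrow> a_perm1 (\<mu> h) (ls h) \<in> carrier (sym_group (ms h))"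
  and a_perm1_action: "\<And>i j. h \<in> {1..n} \<Longrightarrow> (i, j) \<in> diagram (\<mu> h) \<Longrightarrow>
    a_perm1 (\<mu> h) (ls h) (std_num1 (\<mu> h) (i, j)) = std_num1 (\<mu> h) (shift (ls h) 1 i, j)"
proof -
  assume h: "h \<in> {1..n}"
  have inj: "inj_on (std_num1 (\<mu> h)) (diagram (\<mu> h))"
    and img: "std_num1 (\<mu> h) ` diagram (\<mu> h) = {1..ms h}"
    using std_num1_bij[of "\<mu> h"] sum_list_eq[OF h] by (auto simp: bij_betw_def)
  note act = column_cycles_action[OF ls_pos[OF h] inj l_partition[OF h], folded a_perm1_def]
  show "a_perm1 (\<mu> h) (ls h) \<in> carrier (sym_group (ms h))"
    using act(1) unfolding img by (simp add: sym_group_carrier)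
  show "a_perm1 (\<mu> h) (ls h) (std_num1 (\<mu> h) (i, j)) = std_num1 (\<mu> h) (shift (ls h) 1 i, j)"
    if "(i, j) \<in> diagram (\<mu> h)" for i j
    using act(2) that .
qed

lemma a_perm_carrier: "a_perm n \<mu> ls \<in> carrier (sym_group size_m)"
  and a_perm_action: "b \<in> Bx \<Longrightarrow> a_perm n \<mu> ls (std_num n \<mu> b) = std_num n \<mu> (box_shift 1 b)"
proof -
  define t where "t h = (\<lambda>(i, j). std_num n \<mu> (i, j, h))" for h
  define f where "f h = foldr (\<circ>) (column_cycles (ls h) (\<mu> h) (t h)) id" for h
  have t: "t h x = std_num n \<mu> (fst x, snd x, h)" for h x
    by (simp add: t_def split: prod.splits)
  have inj: "inj_on (std_num n \<mu>) Bx" and img: "std_num n \<mu> ` Bx = {1..size_m}"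
    using std_num_bij by (auto simp: bij_betw_def)
  have inj_t: "inj_on (t h) (diagram (\<mu> h))" if "h \<in> {1..n}" for h
  proof (rule inj_onI)
    fix x y assume "x \<in> diagram (\<mu> h)" "y \<in> diagram (\<mu> h)" "t h x = t h y"
    moreover from this have "(fst x, snd x, h) \<in> Bx" "(fst y, snd y, h) \<in> Bx"
      using that by (auto simp: boxes_iff)
    ultimately show "x = y" using inj_onD[OF inj, of "(fst x, snd x, h)" "(fst y, snd y, h)"]
      by (simp add: t prod_eq_iff)
  qed
  note act = column_cycles_action[OF ls_pos inj_t l_partition, folded f_def]
  have set: "set [1..<n + 1] = {1..n}" by auto
  have F: "a_perm n \<mu> ls = foldr (\<circ>) (map f [1..<n + 1]) id"
    unfolding a_perm_def foldr_comp_concat f_def t_def by (simp add: comp_def del: upt_Suc)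
  have "foldr (\<circ>) (map f [1..<n + 1]) id permutes (\<Union>h\<in>set [1..<n + 1]. t h ` diagram (\<mu> h)) \<and>
    (\<forall>h\<in>set [1..<n + 1]. \<forall>x\<in>t h ` diagram (\<mu> h). foldr (\<circ>) (map f [1..<n + 1]) id x = f h x)"
  proof (rule foldr_comp_disjoint)
    fix h h' assume h: "h \<in> set [1..<n + 1]" "h' \<in> set [1..<n + 1]" "h \<noteq> h'"
    show "t h ` diagram (\<mu> h) \<inter> t h' ` diagram (\<mu> h') = {}"
    proof (rule ccontr)
      assume "t h ` diagram (\<mu> h) \<inter> t h' ` diagram (\<mu> h') \<noteq> {}"
      then obtain x y where xy: "x \<in> diagram (\<mu> h)" "y \<in> diagram (\<mu> h')" "t h x = t h' y" by auto
      then have "(fst x, snd x, h) \<in> Bx" "(fst y, snd y, h') \<in> Bx"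
        using h unfolding set by (auto simp: boxes_iff)
      then have "(fst x, snd x, h) = (fst y, snd y, h')"
        using inj_onD[OF inj] xy(3) unfolding t by blast
      with h(3) show False by simp
    qed
  next
    fix h assume "h \<in> set [1..<n + 1]"
    then have "h \<in> {1..n}" unfolding set .
    then show "f h permutes t h ` diagram (\<mu> h)" using act(1) by blast
  qed simp
  note main = this[folded F, unfolded set]
  have "(\<Union>h\<in>{1..n}. t h ` diagram (\<mu> h)) = std_num n \<mu> ` Bx"
    by (force simp: t boxes_iff image_iff)
  with main img show "a_perm n \<mu> ls \<in> carrier (sym_group size_m)"
    by (simp add: sym_group_carrier)
  assume "b \<in> Bx"
  moreover obtain i j h where b: "b = (i, j, h)" by (cases b)
  ultimately have h: "h \<in> {1..n}" and ij: "(i, j) \<in> diagram (\<mu> h)" by (auto simp: boxes_iff)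
  have "a_perm n \<mu> ls (t h (i, j)) = f h (t h (i, j))" using main h ij by blast
  also have "\<dots> = t h (shift (ls h) 1 i, j)" using act(2)[OF h h h] ij by blast
  finally show "a_perm n \<mu> ls (std_num n \<mu> b) = std_num n \<mu> (box_shift 1 b)"
    by (simp add: b t box_shift_def)
qed

lemma a_perm_pow_action:
  fixes k :: int
  assumes "b \<in> Bx"
  shows "(a_perm n \<mu> ls [^]\<^bsub>sym_group size_m\<^esub> k) (std_num n \<mu> b) = std_num n \<mu> (box_shift k b)"
  by (rule sym_group_int_pow_action[where B = Bx])
    (use assms a_perm_carrier a_perm_action box_shift_0 box_shift_add box_shift_in in auto)

text \<open>The k-th power shifts all rows by k, and a row is fixed exactly when l divides k.
  Positivity of \<open>ms h\<close> provides a box on which a nontrivial shift is visible; on an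
  empty diagram every power would be the identity.\<close>

lemma a_perm1_pow_eq_one_iff:
  fixes k :: int
  assumes h: "h \<in> {1..n}"
  shows "a_perm1 (\<mu> h) (ls h) [^]\<^bsub>sym_group (ms h)\<^esub> k = \<one>\<^bsub>sym_group (ms h)\<^esub> \<longleftrightarrow> int (ls h) dvd k"
proof -
  interpret G: group "sym_group (ms h)" by (rule sym_group_is_group)
  let ?p = "a_perm1 (\<mu> h) (ls h) [^]\<^bsub>sym_group (ms h)\<^esub> k"
  have dg: "(i, j) \<in> diagram (\<mu> h) \<Longrightarrow> (shift (ls h) k i, j) \<in> diagram (\<mu> h)" for i j k
    using h by (auto simp: diagram_def part_shift)
  have act: "?p (std_num1 (\<mu> h) b) = std_num1 (\<mu> h) ((\<lambda>k (i, j). (shift (ls h) k i, j)) k b)"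
    if "b \<in> diagram (\<mu> h)" for b
  proof (rule sym_group_int_pow_action[where B = "diagram (\<mu> h)"])
    show "a_perm1 (\<mu> h) (ls h) \<in> carrier (sym_group (ms h))" by (rule a_perm1_carrier[OF h])
  qed (use dg that h a_perm1_action ls_pos in
      \<open>auto simp: diagram_def shift_0 shift_shift simp del: One_nat_def\<close>)
  have inj: "inj_on (std_num1 (\<mu> h)) (diagram (\<mu> h))"
    and img: "std_num1 (\<mu> h) ` diagram (\<mu> h) = {1..ms h}"
    using std_num1_bij[of "\<mu> h"] sum_list_eq[OF h] by (auto simp: bij_betw_def)
  show ?thesis
  proof
    assume "?p = \<one>\<^bsub>sym_group (ms h)\<^esub>"
    then have id: "?p x = x" for x by (simp add: sym_group_one)
    have "diagram (\<mu> h) \<noteq> {}" using img ms_pos[OF h] by auto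
    then obtain i j where ij: "(i, j) \<in> diagram (\<mu> h)" by auto
    then have "std_num1 (\<mu> h) (shift (ls h) k i, j) = std_num1 (\<mu> h) (i, j)"
      using act[OF ij] id by simp
    then have "shift (ls h) k i = i" using inj_onD[OF inj] dg[OF ij] ij by blast
    then show "int (ls h) dvd k"
      using ij ls_pos[OF h] by (subst (asm) shift_eq_iff) (auto simp: diagram_def)
  next
    assume k: "int (ls h) dvd k"
    have "?p x = x" for x
    proof (cases "x \<in> {1..ms h}")
      case True
      then obtain i j where ij: "(i, j) \<in> diagram (\<mu> h)" "x = std_num1 (\<mu> h) (i, j)"
        unfolding img[symmetric] by auto
      moreover from ij have "shift (ls h) k i = i"
        using k ls_pos[OF h] by (subst shift_eq_iff) (auto simp: diagram_def)
      ultimately show ?thesis using act[OF ij(1)] by simp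
    next
      case False
      have "?p \<in> carrier (sym_group (ms h))" using a_perm1_carrier[OF h] by simp
      then show ?thesis using False by (simp add: sym_group_carrier permutes_not_in)
    qed
    then show "?p = \<one>\<^bsub>sym_group (ms h)\<^esub>" by (auto simp: sym_group_one)
  qed
qed

text \<open>The N-th power of a^j is trivial iff l divides j N, that is, iff l / gcd(l, j) divides
  N. This turns the group-theoretic \<gamma> of the theorem into the number of rows in a
  class.\<close>

lemma ord_a_perm1_pow:
  fixes j :: int
  assumes h: "h \<in> {1..n}"
  shows "group.ord (sym_group (ms h)) (a_perm1 (\<mu> h) (ls h) [^]\<^bsub>sym_group (ms h)\<^esub> j)
    = ls h div gcd (ls h) (nat \<bar>j\<bar>)"
proof -
  interpret G: group "sym_group (ms h)" by (rule sym_group_is_group)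
  let ?a = "a_perm1 (\<mu> h) (ls h)"
  have a: "?a \<in> carrier (sym_group (ms h))" by (rule a_perm1_carrier[OF h])
  have "(?a [^]\<^bsub>sym_group (ms h)\<^esub> j) [^]\<^bsub>sym_group (ms h)\<^esub> N = \<one>\<^bsub>sym_group (ms h)\<^esub> \<longleftrightarrow>
    ls h div gcd (ls h) (nat \<bar>j\<bar>) dvd N" for N :: nat
  proof -
    have eq: "(?a [^]\<^bsub>sym_group (ms h)\<^esub> j) [^]\<^bsub>sym_group (ms h)\<^esub> N = ?a [^]\<^bsub>sym_group (ms h)\<^esub> (j * int N)"
      using G.int_pow_pow[OF a, of j "int N"] by (simp add: int_pow_int mult.commute)
    show ?thesis
      unfolding eq a_perm1_pow_eq_one_iff[OF h] dvd_mult_iff_div_gcd_dvd[OF ls_pos[OF h]]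
      by (simp only: int_dvd_int_iff)
  qed
  then show ?thesis using a by (subst G.ord_unique) auto
qed

end

section \<open>Tabloids as row maps\<close>

context multi_l_partition begin

definition rowmap :: "(box \<Rightarrow> nat) \<Rightarrow> nat \<Rightarrow> nat \<times> nat" where
  "rowmap T = (\<lambda>x\<in>{1..size_m}. row_of (inv_into Bx T x))"

definition rowmap_tabloid :: "(nat \<Rightarrow> nat \<times> nat) \<Rightarrow> (box \<Rightarrow> nat) set" where
  "rowmap_tabloid R = {T \<in> numberings n \<mu>. rowmap T = R}"

definition rowmaps :: "(nat \<Rightarrow> nat \<times> nat) set" where
  "rowmaps = {R \<in> {1..size_m} \<rightarrow>\<^sub>E rows.
     \<forall>(i, h)\<in>rows. card {x \<in> {1..size_m}. R x = (i, h)} = part (\<mu> h) i}"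

lemma numberings_iff:
  "T \<in> numberings n \<mu> \<longleftrightarrow> T \<in> extensional Bx \<and> bij_betw T Bx {1..size_m}"
  by (simp add: numberings_def)

lemma numbering_in: "T \<in> numberings n \<mu> \<Longrightarrow> b \<in> Bx \<Longrightarrow> T b \<in> {1..size_m}"
  using bij_betwE numberings_iff by blast

lemma numbering_ex:
  assumes "T \<in> numberings n \<mu>" "x \<in> {1..size_m}"
  obtains b where "b \<in> Bx" "T b = x"
proof -
  have "x \<in> T ` Bx" using assms by (simp add: numberings_iff bij_betw_def)
  then show ?thesis using that by blast
qed

lemma rowmap_apply:
  assumes "T \<in> numberings n \<mu>" "b \<in> Bx"
  shows "rowmap T (T b) = row_of b"
  using assms numbering_in[OF assms] bij_betw_inv_into_left[of T Bx "{1..size_m}" b]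
  by (simp add: rowmap_def numberings_iff)

lemma rowmap_ext: "rowmap T \<in> extensional {1..size_m}"
  by (simp add: rowmap_def)

text \<open>Comparing row maps at the numbers \<open>T b\<close> keeps the inverse of T out of all
  later computations.\<close>

lemma rowmap_eqI:
  assumes T: "T \<in> numberings n \<mu>" and R: "R \<in> extensional {1..size_m}"
    and eq: "\<And>b. b \<in> Bx \<Longrightarrow> R (T b) = row_of b"
  shows "rowmap T = R"
proof (rule extensionalityI[OF rowmap_ext R])
  fix x assume "x \<in> {1..size_m}"
  then obtain b where "b \<in> Bx" "T b = x" using numbering_ex[OF T] by blast
  then show "rowmap T x = R x" using eq rowmap_apply[OF T] by metis
qed

lemma image_row:
  assumes T: "T \<in> numberings n \<mu>"
  shows "T ` row n \<mu> i h = {x \<in> {1..size_m}. rowmap T x = (i, h)}"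
proof (intro equalityI subsetI)
  fix x assume "x \<in> T ` row n \<mu> i h"
  then obtain j where b: "(i, j, h) \<in> Bx" "x = T (i, j, h)" by (auto simp: row_def)
  then show "x \<in> {x \<in> {1..size_m}. rowmap T x = (i, h)}"
    using rowmap_apply[OF T b(1)] numbering_in[OF T b(1)] by (simp add: row_of_def)
next
  fix x assume x: "x \<in> {x \<in> {1..size_m}. rowmap T x = (i, h)}"
  then obtain b where b: "b \<in> Bx" "T b = x" using numbering_ex[OF T] by blast
  with x have "row_of b = (i, h)" using rowmap_apply[OF T b(1)] by simp
  then obtain j where "b = (i, j, h)" by (cases b) (auto simp: row_of_def)
  then show "x \<in> T ` row n \<mu> i h" using b by (auto simp: row_def)
qed

lemma row_equiv_iff:
  assumes "T \<in> numberings n \<mu>" "T' \<in> numberings n \<mu>"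
  shows "(T, T') \<in> row_equiv n \<mu> \<longleftrightarrow> rowmap T = rowmap T'"
proof
  assume r: "(T, T') \<in> row_equiv n \<mu>"
  show "rowmap T = rowmap T'"
  proof (rule extensionalityI[OF rowmap_ext rowmap_ext])
    fix x assume x: "x \<in> {1..size_m}"
    obtain i h where ih: "rowmap T x = (i, h)" by fastforce
    then have "x \<in> T ` row n \<mu> i h" using x image_row[OF assms(1)] by blast
    also have "T ` row n \<mu> i h = T' ` row n \<mu> i h" using r by (simp add: row_equiv_def)
    finally show "rowmap T x = rowmap T' x" using ih image_row[OF assms(2)] by simp
  qed
qed (use assms in \<open>simp add: row_equiv_def image_row\<close>)

lemma tabloid_eq:
  assumes "T \<in> numberings n \<mu>"
  shows "tabloid n \<mu> T = rowmap_tabloid (rowmap T)"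
proof -
  have "T' \<in> tabloid n \<mu> T \<longleftrightarrow> T' \<in> numberings n \<mu> \<and> rowmap T' = rowmap T" for T'
  proof (cases "T' \<in> numberings n \<mu>")
    case True
    then show ?thesis using row_equiv_iff[OF assms True] by (auto simp: tabloid_def)
  qed (auto simp: tabloid_def row_equiv_def)
  then show ?thesis by (auto simp: rowmap_tabloid_def)
qed

lemma tabloids_eq: "tabloids n \<mu> = rowmap_tabloid ` rowmap ` numberings n \<mu>"
proof -
  have "tabloids n \<mu> = tabloid n \<mu> ` numberings n \<mu>"
    by (auto simp: tabloids_def quotient_def tabloid_def)
  also have "\<dots> = rowmap_tabloid ` rowmap ` numberings n \<mu>"
    unfolding image_image by (rule image_cong[OF refl tabloid_eq])
  finally show ?thesis .
qed

lemma card_row: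
  assumes "(i, h) \<in> rows"
  shows "card (row n \<mu> i h) = part (\<mu> h) i"
proof -
  have "row n \<mu> i h = (\<lambda>j. (i, j, h)) ` {1..part (\<mu> h) i}"
    using assms by (auto simp: row_def boxes_iff_rows)
  moreover have "inj_on (\<lambda>j. (i, j, h)) {1..part (\<mu> h) i}" by (auto simp: inj_on_def)
  ultimately show ?thesis by (simp add: card_image)
qed

lemma rowmap_in_rowmaps:
  assumes T: "T \<in> numberings n \<mu>"
  shows "rowmap T \<in> rowmaps"
proof -
  have "rowmap T x \<in> rows" if "x \<in> {1..size_m}" for x
    using numbering_ex[OF T that] rowmap_apply[OF T] row_of_in_rows by metis
  moreover have "card {x \<in> {1..size_m}. rowmap T x = (i, h)} = part (\<mu> h) i" if "(i, h) \<in> rows" for i h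
  proof -
    have "inj_on T (row n \<mu> i h)"
      using T by (auto simp: numberings_iff bij_betw_def row_def intro: inj_on_subset)
    then have "card (T ` row n \<mu> i h) = card (row n \<mu> i h)" by (rule card_image)
    then show ?thesis using image_row[OF T] card_row[OF that] by simp
  qed
  ultimately show ?thesis using rowmap_ext by (auto simp: rowmaps_def PiE_def)
qed

text \<open>The fibre over a row has as many elements as the row has columns. Choosing a bijection
  between the two for every row and gluing them gives a numbering.\<close>

lemma rowmap_surj:
  assumes "R \<in> rowmaps"
  obtains T where "T \<in> numberings n \<mu>" "rowmap T = R"
proof -
  have Rx: "R \<in> extensional {1..size_m}" and R_in: "\<And>x. x \<in> {1..size_m} \<Longrightarrow> R x \<in> rows"
    using assms by (auto simp: rowmaps_def PiE_def)
  have "\<exists>\<phi>. \<forall>p\<in>rows. bij_betw (\<phi> p) {1..part (\<mu> (snd p)) (fst p)} {x \<in> {1..size_m}. R x = p}"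
  proof (rule bchoice, rule ballI)
    fix p assume p: "p \<in> rows"
    have "card {x \<in> {1..size_m}. R x = p} = part (\<mu> (snd p)) (fst p)"
      using assms p by (cases p) (auto simp: rowmaps_def)
    then show "\<exists>\<phi>. bij_betw \<phi> {1..part (\<mu> (snd p)) (fst p)} {x \<in> {1..size_m}. R x = p}"
      by (intro finite_same_card_bij) auto
  qed
  then obtain \<phi> where \<phi>: "\<And>p. p \<in> rows \<Longrightarrow>
    bij_betw (\<phi> p) {1..part (\<mu> (snd p)) (fst p)} {x \<in> {1..size_m}. R x = p}" by blast
  define T where "T = (\<lambda>b\<in>Bx. \<phi> (row_of b) (fst (snd b)))"
  have T_in: "T b \<in> {1..size_m}" "R (T b) = row_of b" if b: "b \<in> Bx" for b
  proof -
    obtain i j h where bb: "b = (i, j, h)" by (cases b)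
    have "(i, h) \<in> rows" "j \<in> {1..part (\<mu> h) i}" using b bb by (auto simp: boxes_iff_rows)
    then have "\<phi> (i, h) j \<in> {x \<in> {1..size_m}. R x = (i, h)}" using bij_betwE[OF \<phi>] by auto
    then show "T b \<in> {1..size_m}" "R (T b) = row_of b"
      using b bb by (auto simp: T_def row_of_def)
  qed
  have "bij_betw T Bx {1..size_m}"
    unfolding bij_betw_def
  proof
    show "inj_on T Bx"
    proof (rule inj_onI)
      fix b b' assume b: "b \<in> Bx" "b' \<in> Bx" "T b = T b'"
      then have r: "row_of b = row_of b'" using T_in by metis
      obtain i j h where bb: "b = (i, j, h)" by (cases b)
      obtain j' where bb': "b' = (i, j', h)" using r bb by (cases b') (auto simp: row_of_def)
      have "(i, h) \<in> rows" "j \<in> {1..part (\<mu> h) i}" "j' \<in> {1..part (\<mu> h) i}"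
        using b bb bb' by (auto simp: boxes_iff_rows)
      moreover have "\<phi> (i, h) j = \<phi> (i, h) j'" using b bb bb' by (simp add: T_def row_of_def)
      ultimately have "j = j'" using \<phi>[of "(i, h)"] by (auto simp: bij_betw_def dest: inj_onD)
      then show "b = b'" using bb bb' by simp
    qed
    show "T ` Bx = {1..size_m}"
    proof (intro equalityI subsetI)
      fix x assume x: "x \<in> {1..size_m}"
      obtain i h where ih: "R x = (i, h)" by fastforce
      have r: "(i, h) \<in> rows" using R_in[OF x] ih by simp
      have "x \<in> \<phi> (i, h) ` {1..part (\<mu> h) i}"
        using \<phi>[OF r] x ih by (auto simp: bij_betw_def)
      then obtain j where j: "j \<in> {1..part (\<mu> h) i}" "x = \<phi> (i, h) j" by blast
      have "(i, j, h) \<in> Bx" using r j by (simp add: boxes_iff_rows)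
      then show "x \<in> T ` Bx"
        using j by (intro image_eqI[of _ _ "(i, j, h)"]) (auto simp: T_def row_of_def)
    qed (use T_in in auto)
  qed
  then have T: "T \<in> numberings n \<mu>" by (simp add: numberings_iff T_def)
  show ?thesis by (rule that[OF T rowmap_eqI[OF T Rx T_in(2)]])
qed

lemma rowmap_image: "rowmap ` numberings n \<mu> = rowmaps"
  using rowmap_in_rowmaps rowmap_surj by blast

lemma rowmap_tabloid_inj: "inj_on rowmap_tabloid rowmaps"
proof (rule inj_onI)
  fix R R' assume "R \<in> rowmaps" and eq: "rowmap_tabloid R = rowmap_tabloid R'"
  then obtain T where "T \<in> numberings n \<mu>" "rowmap T = R" using rowmap_surj by blast
  then have "T \<in> rowmap_tabloid R'" using eq by (auto simp: rowmap_tabloid_def)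
  then show "R = R'" using \<open>rowmap T = R\<close> by (simp add: rowmap_tabloid_def)
qed

section \<open>The two actions in terms of row maps\<close>

lemma left_num_rowmap:
  assumes \<sigma>: "\<sigma> permutes {1..size_m}" and T: "T \<in> numberings n \<mu>"
  shows "left_num n \<mu> \<sigma> T \<in> numberings n \<mu>"
    and "rowmap (left_num n \<mu> \<sigma> T) = (\<lambda>x\<in>{1..size_m}. rowmap T (inv' \<sigma> x))"
proof -
  have "bij_betw (\<sigma> \<circ> T) Bx {1..size_m}"
    using T permutes_imp_bij[OF \<sigma>] bij_betw_trans by (auto simp: numberings_iff)
  then have "bij_betw (left_num n \<mu> \<sigma> T) Bx {1..size_m}"
    by (subst bij_betw_cong[where g = "\<sigma> \<circ> T"]) (auto simp: left_num_def compose_def)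
  then show L: "left_num n \<mu> \<sigma> T \<in> numberings n \<mu>"
    by (simp add: numberings_iff left_num_def compose_def)
  show "rowmap (left_num n \<mu> \<sigma> T) = (\<lambda>x\<in>{1..size_m}. rowmap T (inv' \<sigma> x))"
  proof (rule rowmap_eqI[OF L])
    fix b assume b: "b \<in> Bx"
    then show "(\<lambda>x\<in>{1..size_m}. rowmap T (inv' \<sigma> x)) (left_num n \<mu> \<sigma> T b) = row_of b"
      using numbering_in[OF T b] permutes_in_image[OF \<sigma>] rowmap_apply[OF T b] permutes_inverses(2)[OF \<sigma>]
      by (simp add: left_num_def compose_def)
  qed simp
qed

text \<open>Since \<open>tau\<close> is a definite description, existence and uniqueness are both
  required. The witness is T composed with the inverse of the standard numbering, extended by the
  identity as \<open>permutes\<close> demands.\<close>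

lemma tau_eq:
  assumes T: "T \<in> numberings n \<mu>" and b: "b \<in> Bx"
  shows "tau n \<mu> T (std_num n \<mu> b) = T b"
proof -
  let ?P = "\<lambda>\<tau>. \<tau> permutes {1..size_m} \<and> T = compose Bx \<tau> (std_num n \<mu>)"
  define \<tau> where "\<tau> x = (if x \<in> {1..size_m} then T (inv_into Bx (std_num n \<mu>) x) else x)" for x
  have bij: "bij_betw T Bx {1..size_m}" using T by (simp add: numberings_iff)
  have "bij_betw (T \<circ> inv_into Bx (std_num n \<mu>)) {1..size_m} {1..size_m}"
    by (rule bij_betw_trans[OF bij_betw_inv_into[OF std_num_bij] bij])
  then have "bij_betw \<tau> {1..size_m} {1..size_m}"
    by (subst bij_betw_cong[where g = "T \<circ> inv_into Bx (std_num n \<mu>)"]) (auto simp: \<tau>_def)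
  then have "\<tau> permutes {1..size_m}" by (rule bij_imp_permutes) (auto simp: \<tau>_def)
  moreover have "T = compose Bx \<tau> (std_num n \<mu>)"
  proof (rule extensionalityI)
    show "T \<in> extensional Bx" using T by (simp add: numberings_iff)
    fix c assume "c \<in> Bx"
    then show "T c = compose Bx \<tau> (std_num n \<mu>) c"
      using bij_betwE[OF std_num_bij] bij_betw_inv_into_left[OF std_num_bij]
      by (auto simp: compose_def \<tau>_def)
  qed (simp add: compose_def)
  ultimately have ex: "?P \<tau>" by blast
  moreover have "\<tau>' = \<tau>" if "?P \<tau>'" for \<tau>'
  proof
    fix x
    show "\<tau>' x = \<tau> x"
    proof (cases "x \<in> {1..size_m}")
      case True
      then have "x \<in> std_num n \<mu> ` Bx" using std_num_bij by (simp add: bij_betw_def)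
      then obtain c where c: "c \<in> Bx" "x = std_num n \<mu> c" by blast
      have "compose Bx \<tau>' (std_num n \<mu>) c = compose Bx \<tau> (std_num n \<mu>) c" using ex that by metis
      then show ?thesis using c by (simp add: compose_def)
    next
      case False
      then show ?thesis using ex that by (metis permutes_not_in)
    qed
  qed
  ultimately have "?P (tau n \<mu> T)" unfolding tau_def by (rule theI)
  then have "T b = compose Bx (tau n \<mu> T) (std_num n \<mu>) b" by metis
  then show ?thesis using b by (simp add: compose_def)
qed

text \<open>The new numbering has at box b the entry that T has at the box shifted by k. A number
  therefore moves from the shifted box back to b, which explains the exponent -k on rows.\<close>

lemma right_num_rowmap:
  fixes k :: int
  assumes T: "T \<in> numberings n \<mu>"
  defines "T' \<equiv> right_num n \<mu> T (a_perm n \<mu> ls [^]\<^bsub>sym_group size_m\<^esub> k)"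
  shows "T' \<in> numberings n \<mu>"
    and "rowmap T' = (\<lambda>x\<in>{1..size_m}. row_shift (- k) (rowmap T x))"
proof -
  have T': "T' b = T (box_shift k b)" if "b \<in> Bx" for b
    unfolding T'_def right_num_def compose_def
    using that by (simp add: a_perm_pow_action tau_eq[OF T] box_shift_in)
  have "bij_betw (box_shift k) Bx Bx"
    by (rule bij_betwI[where g = "box_shift (- k)"]) (auto simp: box_shift_in box_shift_add box_shift_0)
  then have "bij_betw (T \<circ> box_shift k) Bx {1..size_m}"
    using T by (auto simp: numberings_iff intro: bij_betw_trans)
  then have "bij_betw T' Bx {1..size_m}"
    by (subst bij_betw_cong[where g = "T \<circ> box_shift k"]) (auto simp: T')
  then show N: "T' \<in> numberings n \<mu>"
    by (simp add: numberings_iff T'_def right_num_def compose_def)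
  show "rowmap T' = (\<lambda>x\<in>{1..size_m}. row_shift (- k) (rowmap T x))"
  proof (rule rowmap_eqI[OF N])
    fix b assume b: "b \<in> Bx"
    have "row_shift (- k) (rowmap T (T' b)) = row_of (box_shift (- k) (box_shift k b))"
      using rowmap_apply[OF T box_shift_in[OF b]] by (simp add: T'[OF b] row_of_box_shift)
    also have "\<dots> = row_of b" using b by (simp add: box_shift_add box_shift_0)
    finally show "(\<lambda>x\<in>{1..size_m}. row_shift (- k) (rowmap T x)) (T' b) = row_of b"
      using numbering_in[OF N b] by simp
  qed simp
qed

text \<open>The row map of a transformed numbering depends only on the row map of the original one.
  Hence the union defining an action on a tabloid runs over equal classes, and the tabloid equation
  becomes an equation of row maps.\<close>

lemma tabloid_rowmap_bij:
  fixes j :: int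
  assumes \<sigma>: "\<sigma> permutes {1..size_m}"
  shows "bij_betw rowmap_tabloid
    {R \<in> rowmaps. \<forall>x\<in>{1..size_m}. R (\<sigma> x) = row_shift (- j) (R x)}
    {X \<in> tabloids n \<mu>. left_tabloid n \<mu> \<sigma> X =
       right_tabloid n \<mu> X (a_perm n \<mu> ls [^]\<^bsub>sym_group size_m\<^esub> (- j))}"
proof -
  let ?a = "a_perm n \<mu> ls [^]\<^bsub>sym_group size_m\<^esub> (- j)"
  have iff: "left_tabloid n \<mu> \<sigma> (rowmap_tabloid R) = right_tabloid n \<mu> (rowmap_tabloid R) ?a \<longleftrightarrow>
    (\<forall>x\<in>{1..size_m}. R (\<sigma> x) = row_shift (- j) (R x))" if R: "R \<in> rowmaps" for R
  proof -
    let ?L = "\<lambda>x\<in>{1..size_m}. R (inv' \<sigma> x)" and ?R = "\<lambda>x\<in>{1..size_m}. row_shift j (R x)"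
    obtain T where T: "T \<in> numberings n \<mu>" "rowmap T = R" using rowmap_surj[OF R] .
    have "left_tabloid n \<mu> \<sigma> (rowmap_tabloid R) = rowmap_tabloid ?L"
      unfolding left_tabloid_def using T
      by (auto simp: rowmap_tabloid_def tabloid_eq left_num_rowmap[OF \<sigma>])
    moreover have "right_tabloid n \<mu> (rowmap_tabloid R) ?a = rowmap_tabloid ?R"
      unfolding right_tabloid_def using T
      by (auto simp: rowmap_tabloid_def tabloid_eq right_num_rowmap)
    \<comment> \<open>Injectivity of \<open>rowmap_tabloid\<close> is available on
      \<open>rowmaps\<close> only; for any other function the class is empty.\<close>
    moreover have "?L \<in> rowmaps" "?R \<in> rowmaps"
      using rowmap_in_rowmaps[OF left_num_rowmap(1)[OF \<sigma> T(1)]]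
        rowmap_in_rowmaps[OF right_num_rowmap(1)[OF T(1), of "- j"]] T
      by (simp_all add: left_num_rowmap[OF \<sigma>] right_num_rowmap)
    ultimately have "left_tabloid n \<mu> \<sigma> (rowmap_tabloid R) = right_tabloid n \<mu> (rowmap_tabloid R) ?a
      \<longleftrightarrow> ?L = ?R"
      using inj_on_eq_iff[OF rowmap_tabloid_inj] by simp
    also have "\<dots> \<longleftrightarrow> (\<forall>x\<in>{1..size_m}. ?L x = ?R x)"
      by (metis extensionalityI restrict_extensional)
    also have "\<dots> \<longleftrightarrow> (\<forall>x\<in>{1..size_m}. R (inv' \<sigma> x) = row_shift j (R x))" by simp
    \<comment> \<open>Substitution of \<sigma> x for x, which is a bijection of the index
      set.\<close>
    also have "\<dots> \<longleftrightarrow> (\<forall>x\<in>{1..size_m}. R x = row_shift j (R (\<sigma> x)))"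
      using permutes_inverses[OF \<sigma>] permutes_in_image[OF \<sigma>] permutes_in_image[OF permutes_inv[OF \<sigma>]]
      by metis
    also have "\<dots> \<longleftrightarrow> (\<forall>x\<in>{1..size_m}. R (\<sigma> x) = row_shift (- j) (R x))"
    proof (rule ball_cong[OF refl])
      fix x assume "x \<in> {1..size_m}"
      then have "R x \<in> rows" "R (\<sigma> x) \<in> rows"
        using R permutes_in_image[OF \<sigma>] by (auto simp: rowmaps_def PiE_def Pi_def)
      then show "R x = row_shift j (R (\<sigma> x)) \<longleftrightarrow> R (\<sigma> x) = row_shift (- j) (R x)"
        using row_shift_add row_shift_0 by fastforce
    qed
    finally show ?thesis .
  qed
  have "bij_betw rowmap_tabloid rowmaps (tabloids n \<mu>)"
    using rowmap_tabloid_inj by (simp add: bij_betw_def tabloids_eq rowmap_image)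
  then show ?thesis
    by (rule bij_betw_Collect) (use iff in blast)
qed

end

section \<open>Equivariant maps and cycles\<close>

lemma permutes_orbit_powers:
  assumes "\<sigma> permutes D" "finite D"
  shows "bij_betw (\<lambda>e. (\<sigma> ^^ e) x) {..<card (orbit \<sigma> x)} (orbit \<sigma> x)"
    and "(\<sigma> ^^ card (orbit \<sigma> x)) x = x"
proof -
  \<comment> \<open>By definition \<open>orbit \<sigma> x\<close> starts at \<sigma> x; that it
    returns to x uses that \<sigma> permutes a finite set.\<close>
  have x: "x \<in> orbit \<sigma> x"
    using assms by (meson permutation_permutes permutation_self_in_orbit)
  let ?d = "funpow_dist1 \<sigma> x x"
  have inj: "inj_on (\<lambda>e. (\<sigma> ^^ e) x) {0..<?d}" by (rule inj_on_funpow_dist1[OF x])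
  have img: "orbit \<sigma> x = (\<lambda>e. (\<sigma> ^^ e) x) ` {0..<?d}" by (rule orbit_conv_funpow_dist1[OF x])
  have c: "card (orbit \<sigma> x) = ?d" unfolding img card_image[OF inj] by simp
  have "{..<?d} = {0..<?d}" by auto
  then show "bij_betw (\<lambda>e. (\<sigma> ^^ e) x) {..<card (orbit \<sigma> x)} (orbit \<sigma> x)"
    unfolding c bij_betw_def using inj img by simp
  show "(\<sigma> ^^ card (orbit \<sigma> x)) x = x"
    unfolding c by (rule funpow_dist1_prop[OF x])
qed

text \<open>The cycle type records only sizes, while the argument needs an index k to name an actual
  cycle. Sorting the orbits themselves by cardinality provides such an enumeration, with some order
  among orbits of equal size.\<close>

lemma cycle_type_orbits:
  obtains ys where "cycle_type m \<sigma> = map card ys" "distinct ys" "set ys = orbit \<sigma> ` {1..m}"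
proof -
  obtain xs where xs: "set xs = orbit \<sigma> ` {1..m}" "distinct xs"
    using finite_distinct_list[of "orbit \<sigma> ` {1..m}"] by auto
  have "image_mset card (mset_set (orbit \<sigma> ` {1..m})) = mset (map card xs)"
    using xs by (metis mset_map mset_set_set)
  then have "cycle_type m \<sigma> = rev (sort (map card xs))"
    unfolding cycle_type_def by (simp only: sorted_list_of_multiset_mset)
  also have "sort (map card xs) = map card (sort_key card xs)"
    by (rule properties_for_sort) simp_all
  finally have "cycle_type m \<sigma> = map card (rev (sort_key card xs))" by (simp add: rev_map)
  then show ?thesis by (rule that) (use xs in auto)
qed

context
  fixes \<sigma> :: "'a \<Rightarrow> 'a" and D :: "'a set" and P :: "'b \<Rightarrow> 'b" and Z :: "'b set"
    and I :: "nat set" and Orb :: "nat \<Rightarrow> 'a set" and rep :: "nat \<Rightarrow> 'a"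
  assumes \<sigma>: "\<sigma> permutes D" and fin: "finite D" and finI: "finite I"
    and orb: "bij_betw Orb I (orbit \<sigma> ` D)"
    and rep: "\<And>k. k \<in> I \<Longrightarrow> rep k \<in> Orb k"
    and P: "\<And>p. p \<in> Z \<Longrightarrow> P p \<in> Z"
begin

lemma rep_in: "k \<in> I \<Longrightarrow> rep k \<in> D" and Orb_eq: "k \<in> I \<Longrightarrow> Orb k = orbit \<sigma> (rep k)"
proof -
  assume k: "k \<in> I"
  then obtain x where x: "x \<in> D" "Orb k = orbit \<sigma> x" using bij_betwE[OF orb] by blast
  have "x \<in> orbit \<sigma> x" using \<sigma> fin by (meson permutation_permutes permutation_self_in_orbit)
  moreover have r: "rep k \<in> orbit \<sigma> x" using rep[OF k] x by simp
  moreover have "orbit \<sigma> x \<subseteq> D" by (rule permutes_orbit_subset[OF \<sigma> x(1)])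
  ultimately show "rep k \<in> D" by blast
  have "cyclic_on \<sigma> (orbit \<sigma> x)"
    using \<sigma> fin by (meson cyclic_on_orbit)
  then show "Orb k = orbit \<sigma> (rep k)" using r x(2) by (metis orbit_cyclic_eq3)
qed

text \<open>The orbits partition the set, and each is listed once by the powers of \<sigma> applied
  to its representative. The pairs (cycle, exponent) serve as coordinates both for extending maps
  and for counting fibres.\<close>

lemma orbit_coordinates_bij:
  "bij_betw (\<lambda>(k, e). (\<sigma> ^^ e) (rep k)) (SIGMA k:I. {..<card (Orb k)}) D"
  unfolding bij_betw_def
proof
  have pw: "bij_betw (\<lambda>e. (\<sigma> ^^ e) (rep k)) {..<card (Orb k)} (Orb k)" if "k \<in> I" for k
    unfolding Orb_eq[OF that] by (rule permutes_orbit_powers(1)[OF \<sigma> fin])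
  have disj: "k = k'" if "k \<in> I" "k' \<in> I" "x \<in> Orb k" "x \<in> Orb k'" for k k' x
  proof -
    have "Orb k = orbit \<sigma> x" "Orb k' = orbit \<sigma> x"
      using that Orb_eq cyclic_on_orbit[OF \<sigma> fin] by (metis orbit_cyclic_eq3)+
    then show ?thesis using orb that(1,2) by (metis bij_betw_def inj_onD)
  qed
  show "inj_on (\<lambda>(k, e). (\<sigma> ^^ e) (rep k)) (SIGMA k:I. {..<card (Orb k)})"
  proof (rule inj_onI, clarify)
    fix k e k' e' assume k: "k \<in> I" "k' \<in> I" and e: "e < card (Orb k)" "e' < card (Orb k')"
      and eq: "(\<sigma> ^^ e) (rep k) = (\<sigma> ^^ e') (rep k')"
    have "(\<sigma> ^^ e) (rep k) \<in> Orb k" "(\<sigma> ^^ e') (rep k') \<in> Orb k'"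
      using bij_betwE[OF pw] k e by blast+
    then have kk: "k = k'" using disj k eq by metis
    then have "e = e'" using pw[OF k(1)] e eq by (auto simp: bij_betw_def dest: inj_onD)
    with kk show "k = k' \<and> e = e'" by simp
  qed
  have "(\<lambda>(k, e). (\<sigma> ^^ e) (rep k)) ` (SIGMA k:I. {..<card (Orb k)}) =
    (\<Union>k\<in>I. (\<lambda>e. (\<sigma> ^^ e) (rep k)) ` {..<card (Orb k)})" by auto
  also have "\<dots> = (\<Union>k\<in>I. Orb k)" using pw by (simp add: bij_betw_def)
  also have "\<dots> = \<Union> (orbit \<sigma> ` D)" using orb by (simp add: bij_betw_def)
  also have "\<dots> = D"
  proof
    show "\<Union> (orbit \<sigma> ` D) \<subseteq> D" using permutes_orbit_subset[OF \<sigma>] by blast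
    show "D \<subseteq> \<Union> (orbit \<sigma> ` D)"
      using \<sigma> fin by (meson permutation_permutes permutation_self_in_orbit UN_I subsetI)
  qed
  finally show "(\<lambda>(k, e). (\<sigma> ^^ e) (rep k)) ` (SIGMA k:I. {..<card (Orb k)}) = D" .
qed

lemma equivariant_funpow:
  assumes "\<And>x. x \<in> D \<Longrightarrow> R (\<sigma> x) = P (R x)" "x \<in> D"
  shows "R ((\<sigma> ^^ e) x) = (P ^^ e) (R x)"
proof (induction e)
  case (Suc e)
  have "(\<sigma> ^^ e) x \<in> D" using assms(2) permutes_in_funpow_image[OF \<sigma>] by simp
  then show ?case using assms(1) Suc by simp
qed simp

text \<open>Along a cycle the values are the iterates of P at the value of the representative. The
  only constraint is that they close up after one full turn.\<close>

lemma equivariant_bij: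
  "bij_betw (\<lambda>R. \<lambda>k\<in>I. R (rep k))
     {R \<in> D \<rightarrow>\<^sub>E Z. \<forall>x\<in>D. R (\<sigma> x) = P (R x)}
     {F \<in> I \<rightarrow>\<^sub>E Z. \<forall>k\<in>I. (P ^^ card (Orb k)) (F k) = F k}"
  unfolding bij_betw_def
proof
  let ?\<beta> = "\<lambda>(k, e). (\<sigma> ^^ e) (rep k)" and ?S = "SIGMA k:I. {..<card (Orb k)}"
  note bij = orbit_coordinates_bij
  have ex: "\<exists>k e. k \<in> I \<and> e < card (Orb k) \<and> x = (\<sigma> ^^ e) (rep k)" if "x \<in> D" for x
  proof -
    have "x \<in> ?\<beta> ` ?S" using that bij by (simp add: bij_betw_def)
    then show ?thesis by auto
  qed
  show "inj_on (\<lambda>R. \<lambda>k\<in>I. R (rep k)) {R \<in> D \<rightarrow>\<^sub>E Z. \<forall>x\<in>D. R (\<sigma> x) = P (R x)}"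
  proof (rule inj_onI, clarify)
    fix R R' assume R: "R \<in> D \<rightarrow>\<^sub>E Z" "\<forall>x\<in>D. R (\<sigma> x) = P (R x)"
      and R': "R' \<in> D \<rightarrow>\<^sub>E Z" "\<forall>x\<in>D. R' (\<sigma> x) = P (R' x)"
      and eq: "(\<lambda>k\<in>I. R (rep k)) = (\<lambda>k\<in>I. R' (rep k))"
    have eqk: "R (rep k) = R' (rep k)" if "k \<in> I" for k using fun_cong[OF eq, of k] that by simp
    show "R = R'"
    proof (rule extensionalityI)
      fix x assume "x \<in> D"
      then obtain k e where k: "k \<in> I" "x = (\<sigma> ^^ e) (rep k)" using ex by blast
      then show "R x = R' x"
        using eqk equivariant_funpow[of R "rep k" e] equivariant_funpow[of R' "rep k" e] R R' rep_in by simp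
    qed (use R R' in \<open>auto simp: PiE_def\<close>)
  qed
  show "(\<lambda>R. \<lambda>k\<in>I. R (rep k)) ` {R \<in> D \<rightarrow>\<^sub>E Z. \<forall>x\<in>D. R (\<sigma> x) = P (R x)} =
    {F \<in> I \<rightarrow>\<^sub>E Z. \<forall>k\<in>I. (P ^^ card (Orb k)) (F k) = F k}"
  proof (intro equalityI subsetI)
    fix F assume "F \<in> (\<lambda>R. \<lambda>k\<in>I. R (rep k)) ` {R \<in> D \<rightarrow>\<^sub>E Z. \<forall>x\<in>D. R (\<sigma> x) = P (R x)}"
    then obtain R where R: "R \<in> D \<rightarrow>\<^sub>E Z" "\<forall>x\<in>D. R (\<sigma> x) = P (R x)" and F: "F = (\<lambda>k\<in>I. R (rep k))"
      by blast
    have "(P ^^ card (Orb k)) (R (rep k)) = R (rep k)" if "k \<in> I" for k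
      using equivariant_funpow[of R "rep k" "card (Orb k)"] R rep_in[OF that]
        permutes_orbit_powers(2)[OF \<sigma> fin, of "rep k"] Orb_eq[OF that] by simp
    then show "F \<in> {F \<in> I \<rightarrow>\<^sub>E Z. \<forall>k\<in>I. (P ^^ card (Orb k)) (F k) = F k}"
      using R(1) rep_in F by auto
  next
    fix F assume "F \<in> {F \<in> I \<rightarrow>\<^sub>E Z. \<forall>k\<in>I. (P ^^ card (Orb k)) (F k) = F k}"
    then have F: "F \<in> I \<rightarrow>\<^sub>E Z" and per: "\<And>k. k \<in> I \<Longrightarrow> (P ^^ card (Orb k)) (F k) = F k" by auto
    \<comment> \<open>The extension of F is written in the coordinates (cycle, exponent) of
      x.\<close>
    define R where "R = (\<lambda>x\<in>D. case inv_into ?S ?\<beta> x of (k, e) \<Rightarrow> (P ^^ e) (F k))"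
    have R_app: "R ((\<sigma> ^^ e) (rep k)) = (P ^^ e) (F k)" if "k \<in> I" "e < card (Orb k)" for k e
    proof -
      have S: "(k, e) \<in> ?S" using that by simp
      have "?\<beta> (k, e) \<in> D" using bij_betwE[OF bij] S by blast
      moreover have "inv_into ?S ?\<beta> (?\<beta> (k, e)) = (k, e)"
        by (rule bij_betw_inv_into_left[OF bij S])
      ultimately show ?thesis by (simp add: R_def)
    qed
    have pos: "0 < card (Orb k)" if "k \<in> I" for k
    proof -
      have "finite (Orb k)" unfolding Orb_eq[OF that]
        using permutes_orbit_subset[OF \<sigma> rep_in[OF that]] fin finite_subset by blast
      then show ?thesis using rep[OF that] by (auto simp: card_gt_0_iff)
    qed
    have PZ: "(P ^^ e) p \<in> Z" if "p \<in> Z" for e p using that P by (induction e) auto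
    have "R \<in> D \<rightarrow>\<^sub>E Z"
    proof (rule PiE_I)
      fix x assume "x \<in> D"
      then obtain k e where "k \<in> I" "e < card (Orb k)" "x = (\<sigma> ^^ e) (rep k)" using ex by blast
      then show "R x \<in> Z" using R_app PZ PiE_mem[OF F] by simp
    qed (simp add: R_def)
    moreover have "R (\<sigma> x) = P (R x)" if xD: "x \<in> D" for x
    proof -
      obtain k e where k: "k \<in> I" "e < card (Orb k)" and x: "x = (\<sigma> ^^ e) (rep k)"
        using ex[OF xD] by blast
      show ?thesis
      proof (cases "Suc e < card (Orb k)")
        case True
        then show ?thesis using R_app[OF k] R_app[OF k(1) True] x by simp
      next
        case False
        \<comment> \<open>At the last point of the cycle the next point is the representative
          itself; the periodicity of F k makes the two values agree.\<close>
        then have c: "card (Orb k) = Suc e" using k by simp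
        have "\<sigma> x = rep k"
          using permutes_orbit_powers(2)[OF \<sigma> fin, of "rep k"] x c Orb_eq[OF k(1)] by simp
        then have "R (\<sigma> x) = F k" using R_app[OF k(1) pos[OF k(1)]] by simp
        also have "\<dots> = P (R x)" using per[OF k(1)] R_app[OF k] x c by simp
        finally show ?thesis .
      qed
    qed
    moreover have "(\<lambda>k\<in>I. R (rep k)) = F"
    proof (rule extensionalityI)
      show "F \<in> extensional I" using F by (simp add: PiE_def)
      fix k assume k: "k \<in> I"
      then show "(\<lambda>k\<in>I. R (rep k)) k = F k" using R_app[OF k pos[OF k]] by simp
    qed simp
    ultimately show "F \<in> (\<lambda>R. \<lambda>k\<in>I. R (rep k)) ` {R \<in> D \<rightarrow>\<^sub>E Z. \<forall>x\<in>D. R (\<sigma> x) = P (R x)}"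
      by (intro image_eqI[of _ _ R]) auto
  qed
qed

text \<open>In orbit coordinates the fibre splits into one set of exponents for each cycle.\<close>

lemma equivariant_card_fibre:
  assumes "\<And>x. x \<in> D \<Longrightarrow> R (\<sigma> x) = P (R x)"
  shows "card {x \<in> D. R x = p} = (\<Sum>k\<in>I. card {e. e < card (Orb k) \<and> (P ^^ e) (R (rep k)) = p})"
proof -
  let ?\<beta> = "\<lambda>(k, e). (\<sigma> ^^ e) (rep k)" and ?S = "SIGMA k:I. {..<card (Orb k)}"
  let ?A = "SIGMA k:I. {e. e < card (Orb k) \<and> (P ^^ e) (R (rep k)) = p}"
  have R: "R (?\<beta> (k, e)) = (P ^^ e) (R (rep k))" if "k \<in> I" for k e
    using equivariant_funpow[of R "rep k" e] assms rep_in[OF that] by simp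
  have "{x \<in> D. R x = p} = {x \<in> ?\<beta> ` ?S. R x = p}"
    using orbit_coordinates_bij by (simp only: bij_betw_def)
  also have "\<dots> = ?\<beta> ` {s \<in> ?S. R (?\<beta> s) = p}" by blast
  also have "{s \<in> ?S. R (?\<beta> s) = p} = ?A" using R by auto
  finally have "{x \<in> D. R x = p} = ?\<beta> ` ?A" .
  moreover have "inj_on ?\<beta> ?A"
    using orbit_coordinates_bij by (auto simp: bij_betw_def intro: inj_on_subset)
  ultimately have "card {x \<in> D. R x = p} = card ?A" by (simp add: card_image)
  also have "\<dots> = (\<Sum>k\<in>I. card {e. e < card (Orb k) \<and> (P ^^ e) (R (rep k)) = p})"
    using finI by simp
  finally show ?thesis .
qed

end

section \<open>Assignments of starting rows to cycles\<close>

locale shifted_multi_l_partition = multi_l_partition +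
  fixes j :: int and \<gamma> :: "nat \<Rightarrow> nat"
  assumes n_pos: "n \<ge> 1"
    and \<gamma>: "\<And>h. h \<in> {1..n} \<Longrightarrow> \<gamma> h = ls h div gcd (ls h) (nat \<bar>j\<bar>)"
begin

text \<open>The distance between consecutive rows of a class, equal to
  \<open>ls h div \<gamma> h\<close>, the vertical spacing of the blocks in condition (ii).\<close>

definition gap :: "nat \<Rightarrow> nat" where
  "gap h = gcd (ls h) (nat \<bar>j\<bar>)"

definition same_class :: "nat \<times> nat \<Rightarrow> nat \<times> nat \<Rightarrow> bool" where
  "same_class = (\<lambda>(i, h) (i', h'). h = h' \<and> class_base (ls h) (gap h) i = class_base (ls h) (gap h) i')"

text \<open>\<open>F k\<close> is the row in which the chosen element of the k-th cycle lies.
  Divisibility says that the cycle closes up under the rotation, and the sums say that every row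
  receives as many numbers as it has boxes.\<close>

definition assignments :: "nat list \<Rightarrow> (nat \<Rightarrow> nat \<times> nat) set" where
  "assignments \<rho> = {F \<in> {1..length \<rho>} \<rightarrow>\<^sub>E rows.
     (\<forall>k\<in>{1..length \<rho>}. \<gamma> (snd (F k)) dvd part \<rho> k) \<and>
     (\<forall>p\<in>rows. (\<Sum>k\<in>{k \<in> {1..length \<rho>}. same_class (F k) p}. part \<rho> k div \<gamma> (snd p))
        = part (\<mu> (snd p)) (fst p))}"

lemma gap_\<gamma>: "h \<in> {1..n} \<Longrightarrow> ls h = gap h * \<gamma> h"
  using \<gamma> unfolding gap_def by (metis dvd_mult_div_cancel gcd_dvd1)

lemma row_shift_funpow:
  assumes "p \<in> rows"
  shows "(row_shift (- j) ^^ e) p = row_shift (- (j * int e)) p"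
proof (induction e)
  case 0
  then show ?case using assms by (simp add: row_shift_0)
next
  case (Suc e)
  then show ?case using assms by (simp add: row_shift_add algebra_simps)
qed

lemma row_shift_period_iff:
  assumes p: "p \<in> rows"
  shows "(row_shift (- j) ^^ N) p = p \<longleftrightarrow> \<gamma> (snd p) dvd N"
proof -
  obtain i h where ih: "p = (i, h)" by (cases p)
  have h: "h \<in> {1..n}" "1 \<le> i" using p ih by (auto simp: rows_iff)
  have "(row_shift (- j) ^^ N) p = p \<longleftrightarrow> shift (ls h) (- (j * int N)) i = i"
    unfolding row_shift_funpow[OF p] by (simp add: ih row_shift_def)
  also have "\<dots> \<longleftrightarrow> int (ls h) dvd j * int N"
    using h ls_pos by (subst shift_eq_iff) auto
  also have "\<dots> \<longleftrightarrow> \<gamma> h dvd N"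
    unfolding \<gamma>[OF h(1)] dvd_mult_iff_div_gcd_dvd[OF ls_pos[OF h(1)]] by (simp only: int_dvd_int_iff)
  finally show ?thesis by (simp add: ih)
qed

lemma card_row_shift_eq:
  assumes p: "p \<in> rows" "p' \<in> rows" and N: "\<gamma> (snd p) dvd N"
  shows "card {e. e < N \<and> (row_shift (- j) ^^ e) p = p'} =
    (if same_class p p' then N div \<gamma> (snd p') else 0)"
proof -
  obtain i h where ih: "p = (i, h)" by (cases p)
  obtain i' h' where ih': "p' = (i', h')" by (cases p')
  have h: "h \<in> {1..n}" "1 \<le> i" "1 \<le> i'" using p ih ih' by (auto simp: rows_iff)
  show ?thesis
  proof (cases "h = h'")
    case True
    have "card {e. e < N \<and> (row_shift (- j) ^^ e) p = p'} =
      card {e. e < N \<and> shift (ls h) (- (j * int e)) i = i'}"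
      unfolding row_shift_funpow[OF p(1)] by (simp add: ih ih' True row_shift_def)
    also have "\<dots> = (if class_base (ls h) (gap h) i = class_base (ls h) (gap h) i'
        then N div (ls h div gap h) else 0)"
      using N \<gamma>[OF h(1)] ls_pos[OF h(1)] h by (intro card_shift_eq) (auto simp: gap_def ih)
    finally show ?thesis using True \<gamma>[OF h(1)] by (simp add: ih ih' same_class_def gap_def)
  next
    case False
    then show ?thesis
      unfolding row_shift_funpow[OF p(1)] by (simp add: ih ih' same_class_def row_shift_def)
  qed
qed

text \<open>Equivariant maps without a condition on fibres correspond to values at representatives.
  On both sides the fibre condition is then imposed; it matches because a full cycle meets every row
  of its class equally often.\<close>

lemma rowmap_assignment_bij:
  assumes \<sigma>: "\<sigma> permutes {1..size_m}"
  shows "\<exists>f. bij_betw f {R \<in> rowmaps. \<forall>x\<in>{1..size_m}. R (\<sigma> x) = row_shift (- j) (R x)}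
    (assignments (cycle_type size_m \<sigma>))"
proof -
  let ?D = "{1..size_m}"
  obtain ys where ys: "cycle_type size_m \<sigma> = map card ys" "distinct ys" "set ys = orbit \<sigma> ` ?D"
    by (rule cycle_type_orbits)
  let ?\<rho> = "cycle_type size_m \<sigma>"
  define I where "I = {1..length ?\<rho>}"
  define Orb where "Orb k = ys ! (k - 1)" for k
  \<comment> \<open>An arbitrary element of every cycle; another choice gives another
    bijection.\<close>
  define rep where "rep k = (SOME x. x \<in> Orb k)" for k
  have orb: "bij_betw Orb I (orbit \<sigma> ` ?D)"
  proof -
    have "bij_betw (\<lambda>k. k - 1) I {..<length ys}"
      by (rule bij_betwI[where g = Suc]) (auto simp: I_def ys(1))
    from bij_betw_trans[OF this bij_betw_nth[OF ys(2) refl ys(3)[symmetric]]]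
    show ?thesis by (simp add: Orb_def[abs_def] comp_def)
  qed
  have part: "part ?\<rho> k = card (Orb k)" if "k \<in> I" for k
    using that by (auto simp: I_def part_def ys(1) Orb_def)
  have rep: "rep k \<in> Orb k" if "k \<in> I" for k
  proof -
    have "Orb k \<in> orbit \<sigma> ` ?D" using bij_betwE[OF orb] that by blast
    then obtain x where "Orb k = orbit \<sigma> x" by blast
    then have "Orb k \<noteq> {}" by (simp add: orbit_nonempty)
    then show ?thesis unfolding rep_def by (simp add: some_in_eq)
  qed
  let ?P = "row_shift (- j)"
  let ?f = "\<lambda>R. \<lambda>k\<in>I. R (rep k)"
  let ?\<R> = "{R \<in> ?D \<rightarrow>\<^sub>E rows. \<forall>x\<in>?D. R (\<sigma> x) = ?P (R x)}"
  let ?\<F> = "{F \<in> I \<rightarrow>\<^sub>E rows. \<forall>k\<in>I. (?P ^^ card (Orb k)) (F k) = F k}"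
  have finI: "finite I" by (simp add: I_def)
  note ctx = \<sigma> finite_atLeastAtMost finI orb rep row_shift_in_rows
  have bij: "bij_betw ?f ?\<R> ?\<F>" by (rule equivariant_bij[OF ctx])
  let ?sum = "\<lambda>F. \<forall>p\<in>rows. (\<Sum>k\<in>{k \<in> I. same_class (F k) p}. part ?\<rho> k div \<gamma> (snd p))
        = part (\<mu> (snd p)) (fst p)"
  let ?fib = "\<lambda>R. \<forall>(i, h)\<in>rows. card {x \<in> ?D. R x = (i, h)} = part (\<mu> h) i"
  have iff: "?sum (?f R) \<longleftrightarrow> ?fib R" if R: "R \<in> ?\<R>" for R
  proof -
    have F: "?f R \<in> ?\<F>" using bij_betwE[OF bij] R by blast
    have Req: "R (\<sigma> x) = ?P (R x)" if "x \<in> ?D" for x using R that by blast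
    have "card {x \<in> ?D. R x = p} = (\<Sum>k\<in>{k \<in> I. same_class (?f R k) p}. part ?\<rho> k div \<gamma> (snd p))"
      if p: "p \<in> rows" for p
    proof -
      have "card {x \<in> ?D. R x = p} = (\<Sum>k\<in>I. card {e. e < card (Orb k) \<and> (?P ^^ e) (R (rep k)) = p})"
        by (rule equivariant_card_fibre[where R = R and P = ?P and rep = rep, OF ctx Req])
      also have "\<dots> = (\<Sum>k\<in>I. if same_class (?f R k) p then part ?\<rho> k div \<gamma> (snd p) else 0)"
      proof (rule sum.cong[OF refl])
        fix k assume k: "k \<in> I"
        then have Rk: "R (rep k) \<in> rows" "(?P ^^ card (Orb k)) (R (rep k)) = R (rep k)"
          using F by (auto simp: PiE_def Pi_def)
        show "card {e. e < card (Orb k) \<and> (?P ^^ e) (R (rep k)) = p} =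
          (if same_class (?f R k) p then part ?\<rho> k div \<gamma> (snd p) else 0)"
          using card_row_shift_eq[OF Rk(1) p] row_shift_period_iff[OF Rk(1)] Rk(2) part[OF k] k by simp
      qed
      also have "\<dots> = (\<Sum>k\<in>{k \<in> I. same_class (?f R k) p}. part ?\<rho> k div \<gamma> (snd p))"
        using finI by (simp only: sum.inter_filter)
      finally show ?thesis .
    qed
    then show ?thesis by (auto split: prod.splits)
  qed
  have "bij_betw ?f {R \<in> ?\<R>. ?fib R} {F \<in> ?\<F>. ?sum F}"
    by (rule bij_betw_Collect[OF bij]) (use iff in blast)
  moreover have "{R \<in> ?\<R>. ?fib R} = {R \<in> rowmaps. \<forall>x\<in>?D. R (\<sigma> x) = row_shift (- j) (R x)}"
    unfolding rowmaps_def by blast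
  moreover have "{F \<in> ?\<F>. ?sum F} = assignments ?\<rho>"
  proof -
    have "(\<forall>k\<in>I. (?P ^^ card (Orb k)) (F k) = F k) \<longleftrightarrow> (\<forall>k\<in>I. \<gamma> (snd (F k)) dvd part ?\<rho> k)"
      if F: "F \<in> I \<rightarrow>\<^sub>E rows" for F
    proof (rule ball_cong[OF refl])
      fix k assume k: "k \<in> I"
      show "(?P ^^ card (Orb k)) (F k) = F k \<longleftrightarrow> \<gamma> (snd (F k)) dvd part ?\<rho> k"
        using row_shift_period_iff[OF PiE_mem[OF F k]] part[OF k] by simp
    qed
    then show ?thesis unfolding assignments_def I_def[symmetric] by blast
  qed
  ultimately show ?thesis by metis
qed

end

section \<open>Fillings by cycles\<close>

text \<open>In a weakly increasing row the entries at most k form an initial segment, so the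
  position x lies in it iff the count of these entries is at least x. A row is thus recovered from
  its multiplicities, by the expression that defines \<open>filling\<close>.\<close>

lemma mono_eq_Least_card:
  fixes y :: "nat \<Rightarrow> nat"
  assumes mono: "\<And>a b. 1 \<le> a \<Longrightarrow> a \<le> b \<Longrightarrow> b \<le> N \<Longrightarrow> y a \<le> y b"
    and pos: "\<And>a. 1 \<le> a \<Longrightarrow> a \<le> N \<Longrightarrow> 1 \<le> y a"
    and x: "1 \<le> x" "x \<le> N"
  shows "y x = (LEAST k. x \<le> (\<Sum>k'\<in>{1..k}. card {a \<in> {1..N}. y a = k'}))"
proof -
  have "x \<le> (\<Sum>k'\<in>{1..k}. card {a \<in> {1..N}. y a = k'}) \<longleftrightarrow> y x \<le> k" for k
  proof -
    have "(\<Sum>k'\<in>{1..k}. card {a \<in> {1..N}. y a = k'}) = card (\<Union>k'\<in>{1..k}. {a \<in> {1..N}. y a = k'})"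
      by (subst card_UN_disjoint) auto
    also have "(\<Union>k'\<in>{1..k}. {a \<in> {1..N}. y a = k'}) = {a \<in> {1..N}. y a \<le> k}"
      using pos by auto
    finally have eq: "(\<Sum>k'\<in>{1..k}. card {a \<in> {1..N}. y a = k'}) = card {a \<in> {1..N}. y a \<le> k}" .
    show ?thesis
    proof
      assume le: "x \<le> (\<Sum>k'\<in>{1..k}. card {a \<in> {1..N}. y a = k'})"
      show "y x \<le> k"
      proof (rule ccontr)
        assume "\<not> y x \<le> k"
        then have "{a \<in> {1..N}. y a \<le> k} \<subseteq> {1..<x}"
          using mono[OF x(1)] by (force simp: not_le[symmetric])
        then have "card {a \<in> {1..N}. y a \<le> k} \<le> card {1..<x}" by (intro card_mono) auto
        then show False using le eq x by simp
      qed
    next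
      assume "y x \<le> k"
      then have "{1..x} \<subseteq> {a \<in> {1..N}. y a \<le> k}" using mono x order_trans by fastforce
      then have "card {1..x} \<le> card {a \<in> {1..N}. y a \<le> k}" by (intro card_mono) auto
      then show "x \<le> (\<Sum>k'\<in>{1..k}. card {a \<in> {1..N}. y a = k'})" using eq by simp
    qed
  qed
  then have "(LEAST k. x \<le> (\<Sum>k'\<in>{1..k}. card {a \<in> {1..N}. y a = k'})) = (LEAST k. y x \<le> k)"
    by simp
  also have "\<dots> = y x" by (rule Least_equality) auto
  finally show ?thesis ..
qed

locale cycle_filling = shifted_multi_l_partition +
  fixes \<rho> :: "nat list"
  assumes \<rho>_pos: "\<And>r. r \<in> set \<rho> \<Longrightarrow> 0 < r"
begin

abbreviation "I \<equiv> {1..length \<rho>}"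

abbreviation base :: "nat \<Rightarrow> nat \<Rightarrow> nat" where
  "base h \<equiv> class_base (ls h) (gap h)"

text \<open>The block of condition (ii) in natural numbers: b is its first row and a the number of
  columns to its left, so s counts from 0 and t from 1.\<close>

definition block :: "nat \<Rightarrow> nat \<Rightarrow> nat \<Rightarrow> nat \<Rightarrow> box set" where
  "block k h b a = {(b + gap h * s, a + t, h) | s t. s < \<gamma> h \<and> 1 \<le> t \<and> t \<le> part \<rho> k div \<gamma> h}"

text \<open>The intended multiplicity of the value k in row p. Accordingly \<open>cum_mult\<close>
  is the number of entries of the row that are at most k.\<close>

definition mult :: "(nat \<Rightarrow> nat \<times> nat) \<Rightarrow> nat \<times> nat \<Rightarrow> nat \<Rightarrow> nat" where
  "mult F p k = (if k \<in> I \<and> same_class (F k) p then part \<rho> k div \<gamma> (snd p) else 0)"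

definition cum_mult :: "(nat \<Rightarrow> nat \<times> nat) \<Rightarrow> nat \<times> nat \<Rightarrow> nat \<Rightarrow> nat" where
  "cum_mult F p k = (\<Sum>k'\<in>{1..k}. mult F p k')"

definition filling :: "(nat \<Rightarrow> nat \<times> nat) \<Rightarrow> box \<Rightarrow> nat" where
  "filling F = (\<lambda>(i, x, h)\<in>Bx. LEAST k. x \<le> cum_mult F (i, h) k)"

definition marking :: "(nat \<Rightarrow> nat \<times> nat) \<Rightarrow> nat \<Rightarrow> nat \<times> int" where
  "marking F = (\<lambda>k\<in>I. (snd (F k), int (class_offset (ls (snd (F k))) (gap (snd (F k))) (fst (F k)))))"

lemma part_\<rho>_pos_iff: "0 < part \<rho> k \<longleftrightarrow> k \<in> I"
  using \<rho>_pos[of "\<rho> ! (k - 1)"] nth_mem[of "k - 1" \<rho>] by (auto simp: part_def)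

lemma Collect_part_\<rho>: "{k. part \<rho> k \<noteq> 0} = I"
  unfolding neq0_conv part_\<rho>_pos_iff by (rule Collect_mem_eq)

lemma gap_pos: "h \<in> {1..n} \<Longrightarrow> 0 < gap h" and \<gamma>_pos: "h \<in> {1..n} \<Longrightarrow> 0 < \<gamma> h"
proof -
  assume "h \<in> {1..n}"
  then have "0 < gap h * \<gamma> h" using gap_\<gamma>[of h] ls_pos[of h] by simp
  then show "0 < gap h" "0 < \<gamma> h" by simp_all
qed

lemma gap_dvd: "h \<in> {1..n} \<Longrightarrow> gap h dvd ls h"
  using gap_\<gamma>[of h] by simp

lemma ls_div_\<gamma>: "h \<in> {1..n} \<Longrightarrow> ls h div \<gamma> h = gap h"
  using gap_\<gamma>[of h] \<gamma>_pos[of h] by simp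

lemma base_row:
  assumes "h \<in> {1..n}" "s < \<gamma> h"
  shows "base h (base h i + gap h * s) = base h i"
  using class_row_arith(2)[OF gap_\<gamma>[OF assms(1)] ls_pos[OF assms(1)] assms(2)] .

lemma base_base: "h \<in> {1..n} \<Longrightarrow> base h (base h i) = base h i"
  using base_row[of h 0 i] \<gamma>_pos[of h] by simp

lemma base_decomp:
  assumes "h \<in> {1..n}" "1 \<le> i"
  obtains s where "s < \<gamma> h" "i = base h i + gap h * s"
  using class_offset_less[OF gap_\<gamma>[OF assms(1)] ls_pos[OF assms(1)], of i]
    class_base_offset[OF gap_dvd[OF assms(1)] assms(2)] that[of "class_offset (ls h) (gap h) i"]
  by simp

lemma part_class:
  assumes "h \<in> {1..n}" "1 \<le> i" "1 \<le> i'" "base h i = base h i'"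
  shows "part (\<mu> h) i = part (\<mu> h) i'"
  by (rule part_block[OF assms(1-3)])
    (use assms(4) class_base_eq_iff[OF gap_dvd[OF assms(1)] ls_pos[OF assms(1)] assms(2,3)] in blast)

text \<open>When b is the first row of a class, the rows at multiples of the gap below b are exactly
  the rows of that class.\<close>

lemma block_row_iff:
  assumes h: "h \<in> {1..n}" and b: "base h b = b" and i: "1 \<le> i"
  shows "(i, x, h) \<in> block k h b a \<longleftrightarrow> base h i = b \<and> a < x \<and> x \<le> a + part \<rho> k div \<gamma> h"
proof
  assume "(i, x, h) \<in> block k h b a"
  then obtain s t where "s < \<gamma> h" "i = b + gap h * s" "x = a + t" "1 \<le> t" "t \<le> part \<rho> k div \<gamma> h"
    by (auto simp: block_def)
  then show "base h i = b \<and> a < x \<and> x \<le> a + part \<rho> k div \<gamma> h"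
    using base_row[OF h, of s b] b by simp
next
  assume x: "base h i = b \<and> a < x \<and> x \<le> a + part \<rho> k div \<gamma> h"
  obtain s where "s < \<gamma> h" "i = base h i + gap h * s" using base_decomp[OF h i] .
  then show "(i, x, h) \<in> block k h b a"
    unfolding block_def using x by (intro CollectI exI[of _ s] exI[of _ "x - a"]) auto
qed

lemma card_block:
  assumes h: "h \<in> {1..n}" and d: "\<gamma> h dvd part \<rho> k"
  shows "card (block k h b a) = part \<rho> k"
proof -
  have "block k h b a = (\<lambda>(s, t). (b + gap h * s, a + t, h)) ` ({..<\<gamma> h} \<times> {1..part \<rho> k div \<gamma> h})"
    by (auto simp: block_def image_iff)
  moreover have "inj_on (\<lambda>(s, t). (b + gap h * s, a + t, h)) ({..<\<gamma> h} \<times> {1..part \<rho> k div \<gamma> h})"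
    using gap_pos[OF h] by (auto simp: inj_on_def)
  ultimately have "card (block k h b a) = \<gamma> h * (part \<rho> k div \<gamma> h)"
    by (simp add: card_image card_cartesian_product)
  then show ?thesis using d by simp
qed

lemma block_nonempty:
  assumes "h \<in> {1..n}" "\<gamma> h dvd part \<rho> k" "k \<in> I"
  shows "(b, a + 1, h) \<in> block k h b a"
proof -
  have "\<gamma> h \<le> part \<rho> k" using assms part_\<rho>_pos_iff[of k] by (auto intro: dvd_imp_le)
  then have "1 \<le> part \<rho> k div \<gamma> h" using \<gamma>_pos[OF assms(1)] by (simp add: Suc_le_eq div_greater_zero_iff)
  then show ?thesis
    unfolding block_def using \<gamma>_pos[OF assms(1)] by (intro CollectI exI[of _ 0] exI[of _ 1]) auto
qed

text \<open>The offset \<open>(i', j')\<close> of condition (ii) is \<open>(b - gap h, a)\<close>, so that \<open>b\<close> is the first row of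
  the block.\<close>

lemma int_block:
  assumes h: "h \<in> {1..n}"
  shows "(\<lambda>(i, j, h). (int i, int j, h)) ` block k h b a =
    {(int s * int (ls h div \<gamma> h) + (int b - int (gap h)), int t + int a, h) | s t.
       1 \<le> s \<and> s \<le> \<gamma> h \<and> 1 \<le> t \<and> t \<le> part \<rho> k div \<gamma> h}" (is "?L = ?R")
proof (intro equalityI subsetI)
  fix z assume "z \<in> ?L"
  then obtain s t where "s < \<gamma> h" "1 \<le> t" "t \<le> part \<rho> k div \<gamma> h"
    and z: "z = (int (b + gap h * s), int (a + t), h)" by (auto simp: block_def)
  then show "z \<in> ?R"
    unfolding ls_div_\<gamma>[OF h] by (intro CollectI exI[of _ "Suc s"] exI[of _ t]) (auto simp: algebra_simps)
next
  fix z assume "z \<in> ?R"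
  then obtain s t where s: "1 \<le> s" "s \<le> \<gamma> h" and t: "1 \<le> t" "t \<le> part \<rho> k div \<gamma> h"
    and z: "z = (int s * int (gap h) + (int b - int (gap h)), int t + int a, h)"
    unfolding ls_div_\<gamma>[OF h] by auto
  obtain s' where s': "s = Suc s'" using s(1) by (cases s) auto
  have "(b + gap h * s', a + t, h) \<in> block k h b a" using s t s' by (auto simp: block_def)
  then show "z \<in> ?L"
    by (rule rev_image_eqI) (auto simp: z s' algebra_simps)
qed

text \<open>Since multiplicities depend only on the class, each value starts and ends in the same
  columns in all rows of the class. This is why the preimages under a filling are rectangular
  blocks.\<close>

lemma mult_class_cong: "same_class p p' \<Longrightarrow> mult F p k = mult F p' k"
  by (cases p, cases p', cases "F k") (auto simp: mult_def same_class_def)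

lemma cum_mult_class_cong: "same_class p p' \<Longrightarrow> cum_mult F p k = cum_mult F p' k"
  by (simp add: cum_mult_def mult_class_cong[of p p'])

lemma cum_mult_step: "1 \<le> k \<Longrightarrow> cum_mult F p k = cum_mult F p (k - 1) + mult F p k"
  by (cases k) (simp_all add: cum_mult_def)

lemma cum_mult_mono: "k \<le> k' \<Longrightarrow> cum_mult F p k \<le> cum_mult F p k'"
  unfolding cum_mult_def by (rule sum_mono2) auto

lemma sum_mult: "(\<Sum>k\<in>{k \<in> I. same_class (F k) p}. part \<rho> k div \<gamma> (snd p)) = cum_mult F p (length \<rho>)"
proof -
  have "(\<Sum>k\<in>{k \<in> I. same_class (F k) p}. part \<rho> k div \<gamma> (snd p)) =
    (\<Sum>k\<in>I. if same_class (F k) p then part \<rho> k div \<gamma> (snd p) else 0)"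
    by (rule sum.inter_filter) simp
  also have "\<dots> = cum_mult F p (length \<rho>)"
    unfolding cum_mult_def by (rule sum.cong) (simp_all add: mult_def)
  finally show ?thesis .
qed

lemma cum_mult_le:
  assumes "F \<in> assignments \<rho>" "p \<in> rows"
  shows "cum_mult F p k \<le> part (\<mu> (snd p)) (fst p)"
proof -
  have top: "cum_mult F p (length \<rho>) = part (\<mu> (snd p)) (fst p)"
    using assms sum_mult[where F = F and p = p] by (simp add: assignments_def)
  show ?thesis
  proof (cases "k \<le> length \<rho>")
    case True
    then show ?thesis using cum_mult_mono top by metis
  next
    case False
    then have "cum_mult F p k = cum_mult F p (length \<rho>)"
      unfolding cum_mult_def by (intro sum.mono_neutral_right) (auto simp: mult_def)
    then show ?thesis using top by simp
  qed
qed

lemma filling_eq_iff: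
  assumes F: "F \<in> assignments \<rho>" and x: "(i, x, h) \<in> Bx" and k: "1 \<le> k"
  shows "filling F (i, x, h) = k \<longleftrightarrow> cum_mult F (i, h) (k - 1) < x \<and> x \<le> cum_mult F (i, h) k"
proof -
  let ?P = "\<lambda>k. x \<le> cum_mult F (i, h) k"
  have r: "(i, h) \<in> rows" "x \<le> part (\<mu> h) i" using x by (auto simp: boxes_iff_rows)
  have "cum_mult F (i, h) (length \<rho>) = part (\<mu> h) i"
    using F r sum_mult[where F = F and p = "(i, h)"] by (auto simp: assignments_def)
  \<comment> \<open>The multiplicities add up to the full row length, so the set whose least element
    defines the filling is nonempty.\<close>
  then have "?P (length \<rho>)" using r by simp
  then have least: "?P (LEAST k. ?P k)" by (rule LeastI)
  have fill: "filling F (i, x, h) = (LEAST k. ?P k)" using x by (simp add: filling_def)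
  show ?thesis
  proof
    assume eq: "filling F (i, x, h) = k"
    then have "k - 1 < (LEAST k. ?P k)" using fill k by simp
    then have "\<not> ?P (k - 1)" by (rule not_less_Least)
    then show "cum_mult F (i, h) (k - 1) < x \<and> ?P k" using least fill eq by simp
  next
    assume a: "cum_mult F (i, h) (k - 1) < x \<and> ?P k"
    have "(LEAST k. ?P k) = k"
    proof (rule Least_equality)
      fix k' assume k': "?P k'"
      show "k \<le> k'"
      proof (rule ccontr)
        assume "\<not> k \<le> k'"
        then have "cum_mult F (i, h) k' \<le> cum_mult F (i, h) (k - 1)" by (intro cum_mult_mono) simp
        then show False using a k' by simp
      qed
    qed (use a in simp)
    then show "filling F (i, x, h) = k" using fill by simp
  qed
qed

lemma filling_ge_1:
  assumes F: "F \<in> assignments \<rho>" and b: "b \<in> Bx"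
  shows "1 \<le> filling F b"
proof -
  obtain i x h where b': "b = (i, x, h)" by (cases b)
  have x: "1 \<le> x" "(i, h) \<in> rows" "x \<le> part (\<mu> h) i" using b b' by (auto simp: boxes_iff_rows)
  have "cum_mult F (i, h) (length \<rho>) = part (\<mu> h) i"
    using F x sum_mult[where F = F and p = "(i, h)"] by (auto simp: assignments_def)
  then have "x \<le> cum_mult F (i, h) (length \<rho>)" using x by simp
  then have "x \<le> cum_mult F (i, h) (LEAST k. x \<le> cum_mult F (i, h) k)" by (rule LeastI)
  moreover have "cum_mult F (i, h) 0 = 0" by (simp add: cum_mult_def)
  ultimately have "(LEAST k. x \<le> cum_mult F (i, h) k) \<noteq> 0" using x(1) by (metis not_one_le_zero le_zero_eq)
  then show ?thesis using b b' by (simp add: filling_def)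
qed

text \<open>In every row of the class of \<open>F k\<close> the value k occupies the columns between
  two consecutive cumulative counts, and these counts agree throughout the class; in all other rows
  its multiplicity is 0.\<close>

lemma preim_filling:
  assumes F: "F \<in> assignments \<rho>" and k: "k \<in> I" and Fk: "F k = (i0, h0)"
  shows "preim n \<mu> (filling F) k = block k h0 (base h0 i0) (cum_mult F (F k) (k - 1))"
proof -
  have h0: "h0 \<in> {1..n}" and i0: "1 \<le> i0" and r0: "(i0, h0) \<in> rows"
    using F k Fk rows_iff by (auto simp: assignments_def PiE_def Pi_def)
  have "(i, x, h) \<in> preim n \<mu> (filling F) k \<longleftrightarrow> (i, x, h) \<in> block k h0 (base h0 i0) (cum_mult F (F k) (k - 1))"
    for i x h
  proof
    assume "(i, x, h) \<in> preim n \<mu> (filling F) k"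
    then have b: "(i, x, h) \<in> Bx" "filling F (i, x, h) = k" by (auto simp: preim_def)
    have i: "1 \<le> i" using b(1) by (simp add: boxes_def)
    have lt: "cum_mult F (i, h) (k - 1) < x" "x \<le> cum_mult F (i, h) k"
      using filling_eq_iff[OF F b(1)] b(2) k by auto
    then have "mult F (i, h) k \<noteq> 0" using cum_mult_step[of k F "(i, h)"] k by auto
    then have sc: "same_class (F k) (i, h)" by (auto simp: mult_def split: if_splits)
    then have h: "h = h0" and bi: "base h0 i = base h0 i0" by (auto simp: same_class_def Fk)
    have "cum_mult F (F k) (k - 1) = cum_mult F (i, h) (k - 1)" by (rule cum_mult_class_cong[OF sc])
    moreover have "cum_mult F (i, h) k = cum_mult F (i, h) (k - 1) + part \<rho> k div \<gamma> h"
      using cum_mult_step[of k F "(i, h)"] k sc by (simp add: mult_def)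
    ultimately show "(i, x, h) \<in> block k h0 (base h0 i0) (cum_mult F (F k) (k - 1))"
      unfolding h using lt bi h block_row_iff[OF h0 base_base[OF h0] i] by simp
  next
    assume a: "(i, x, h) \<in> block k h0 (base h0 i0) (cum_mult F (F k) (k - 1))"
    then have h: "h = h0" and "base h0 i0 \<le> i" by (auto simp: block_def)
    then have i: "1 \<le> i" using class_base_ge_1(1)[of "ls h0" "gap h0" i0] by linarith
    have bi: "base h0 i = base h0 i0" and x: "cum_mult F (F k) (k - 1) < x"
      "x \<le> cum_mult F (F k) (k - 1) + part \<rho> k div \<gamma> h0"
      using a block_row_iff[OF h0 base_base[OF h0] i] unfolding h by auto
    have sc: "same_class (F k) (i, h)" using bi h by (simp add: same_class_def Fk)
    have cum: "cum_mult F (F k) k' = cum_mult F (i, h) k'" for k' by (rule cum_mult_class_cong[OF sc])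
    have st: "cum_mult F (i, h) k = cum_mult F (i, h) (k - 1) + part \<rho> k div \<gamma> h"
      using cum_mult_step[of k F "(i, h)"] k sc by (simp add: mult_def)
    \<comment> \<open>That the block lies inside the diagram needs two facts: the rows of a class
      have equal length, and the cumulative counts never exceed it.\<close>
    have r: "(i, h) \<in> rows"
      using r0 part_class[OF h0 i i0 bi] i h by (simp add: rows_iff)
    have "x \<le> part (\<mu> h) i" using x cum st h cum_mult_le[OF F r, of k] by simp
    then have b: "(i, x, h) \<in> Bx" using r x by (simp add: boxes_iff_rows)
    then have "filling F (i, x, h) = k"
      using filling_eq_iff[OF F b, of k] x cum st h k by simp
    then show "(i, x, h) \<in> preim n \<mu> (filling F) k" using b by (simp add: preim_def)
  qed
  then show ?thesis by auto
qed

lemma preim_filling_empty: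
  assumes F: "F \<in> assignments \<rho>" and k: "1 \<le> k" "k \<notin> I"
  shows "preim n \<mu> (filling F) k = {}"
proof -
  have False if b: "(i, x, h) \<in> Bx" "filling F (i, x, h) = k" for i x h
  proof -
    have "cum_mult F (i, h) (k - 1) < x" "x \<le> cum_mult F (i, h) k"
      using filling_eq_iff[OF F b(1) k(1)] b(2) by auto
    moreover have "mult F (i, h) k = 0" using k(2) by (auto simp: mult_def)
    ultimately show False using cum_mult_step[OF k(1), of F "(i, h)"] by linarith
  qed
  then show ?thesis by (auto simp: preim_def)
qed

lemma assignment_row:
  assumes "F \<in> assignments \<rho>" "k \<in> I"
  obtains i h where "F k = (i, h)" "h \<in> {1..n}" "1 \<le> i" "\<gamma> h dvd part \<rho> k"
proof -
  obtain i h where Fk: "F k = (i, h)" by fastforce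
  have "F k \<in> rows" "\<gamma> (snd (F k)) dvd part \<rho> k"
    using assms by (auto simp: assignments_def PiE_def Pi_def)
  then show ?thesis using that[OF Fk] by (auto simp: Fk rows_iff)
qed

lemma filling_rho_tabloid:
  assumes F: "F \<in> assignments \<rho>"
  shows "filling F \<in> rho_tabloids \<rho> \<gamma> n ls \<mu>"
proof -
  have blk: "card (preim n \<mu> (filling F) k) = part \<rho> k \<and>
    (\<exists>h\<in>{1..n}. \<exists>i' j' :: int. \<gamma> h dvd part \<rho> k \<and>
           (\<lambda>(i, j, h). (int i, int j, h)) ` preim n \<mu> (filling F) k =
             {(int s * int (ls h div \<gamma> h) + i', int t + j', h) | s t.
                1 \<le> s \<and> s \<le> \<gamma> h \<and> 1 \<le> t \<and> t \<le> part \<rho> k div \<gamma> h})" if k1: "1 \<le> k" for k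
  proof (cases "k \<in> I")
    case True
    obtain i h where Fk: "F k = (i, h)" and h: "h \<in> {1..n}" and d: "\<gamma> h dvd part \<rho> k"
      using assignment_row[OF F True] .
    show ?thesis
      unfolding preim_filling[OF F True Fk]
      using card_block[OF h d] int_block[OF h] h d by blast
  next
    case False
    then have z: "part \<rho> k = 0" using part_\<rho>_pos_iff[of k] by blast
    \<comment> \<open>For an index past the last part the block is empty and \<gamma> divides 0, but
      condition (ii) still asks for some component; any one will do, and \<open>n_pos\<close>
      supplies it.\<close>
    have "1 \<in> {1..n}" using n_pos by simp
    then show ?thesis unfolding preim_filling_empty[OF F k1 False] z
      by (intro conjI bexI[of _ 1] exI[of _ 0]) auto
  qed
  have mono: "filling F (i, x, h) \<le> filling F (i, y, h)"
    if b: "(i, x, h) \<in> Bx" "(i, y, h) \<in> Bx" "x \<le> y" for i x y h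
  proof -
    have "y \<le> cum_mult F (i, h) (filling F (i, y, h))"
      using filling_eq_iff[OF F b(2) filling_ge_1[OF F b(2)]] by simp
    then have "(LEAST k. x \<le> cum_mult F (i, h) k) \<le> filling F (i, y, h)"
      using b(3) by (intro Least_le) simp
    then show ?thesis using b(1) by (simp add: filling_def)
  qed
  have fn: "filling F \<in> Bx \<rightarrow>\<^sub>E {1..}"
    using filling_ge_1[OF F] by (intro PiE_I) (auto simp: filling_def)
  show ?thesis
    unfolding rho_tabloids_def
  proof (intro CollectI conjI allI impI)
    show "filling F \<in> Bx \<rightarrow>\<^sub>E {1..}" by (rule fn)
  qed (use blk mono in \<open>simp_all only:\<close>)
qed

lemma filling_marked:
  assumes F: "F \<in> assignments \<rho>"
  shows "(filling F, marking F) \<in> marked_tabloids \<rho> \<gamma> n ls \<mu>"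
proof -
  have "marking F \<in> I \<rightarrow>\<^sub>E (SIGMA h:{1..n}. carrier (integer_mod_group (\<gamma> h)))"
  proof (rule PiE_I)
    fix k assume k: "k \<in> I"
    obtain i h where Fk: "F k = (i, h)" and h: "h \<in> {1..n}" using assignment_row[OF F k] .
    show "marking F k \<in> (SIGMA h:{1..n}. carrier (integer_mod_group (\<gamma> h)))"
      using k h class_offset_less[OF gap_\<gamma>[OF h] ls_pos[OF h], of i] \<gamma>_pos[OF h]
      by (simp add: marking_def Fk carrier_integer_mod_group)
  qed (auto simp: marking_def)
  moreover have "fst (marking F k) = h'"
    if "part \<rho> k \<noteq> 0" "preim n \<mu> (filling F) k \<subseteq> {(i, j, h') | i j h'. h' = h}" "h' = h" for k h h'
  proof -
    have k: "k \<in> I" using that(1) part_\<rho>_pos_iff by simp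
    obtain i h0 where Fk: "F k = (i, h0)" and h0: "h0 \<in> {1..n}" and d: "\<gamma> h0 dvd part \<rho> k"
      using assignment_row[OF F k] .
    \<comment> \<open>The preimage of k contains a box, so it determines its component.\<close>
    have "h0 = h"
      using block_nonempty[OF h0 d k] that(2) unfolding preim_filling[OF F k Fk] by blast
    then show ?thesis using k that(3) by (simp add: marking_def Fk)
  qed
  ultimately show ?thesis
    unfolding marked_tabloids_def Collect_part_\<rho> using filling_rho_tabloid[OF F] by blast
qed

text \<open>The mark gives the component and the offset of the row \<open>F k\<close>; the first row
  of the block of k gives the base of its class. Base and offset together determine the row.\<close>

lemma filling_marking_inj: "inj_on (\<lambda>F. (filling F, marking F)) (assignments \<rho>)"
proof (rule inj_onI)
  fix F F' assume F: "F \<in> assignments \<rho>" and F': "F' \<in> assignments \<rho>"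
    and eq: "(filling F, marking F) = (filling F', marking F')"
  show "F = F'"
  proof (rule extensionalityI[of _ I])
    show "F \<in> extensional I" "F' \<in> extensional I"
      using F F' by (auto simp: assignments_def PiE_def)
    fix k assume k: "k \<in> I"
    obtain i h where Fk: "F k = (i, h)" and h: "h \<in> {1..n}" "1 \<le> i" "\<gamma> h dvd part \<rho> k"
      using assignment_row[OF F k] .
    obtain i' h' where Fk': "F' k = (i', h')" and h': "h' \<in> {1..n}" "1 \<le> i'" "\<gamma> h' dvd part \<rho> k"
      using assignment_row[OF F' k] .
    have "marking F k = marking F' k" using eq by simp
    then have hh: "h' = h" and off: "class_offset (ls h) (gap h) i = class_offset (ls h) (gap h) i'"
      using k by (auto simp: marking_def Fk Fk')
    have "(base h i, cum_mult F (F k) (k - 1) + 1, h) \<in> preim n \<mu> (filling F) k"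
      unfolding preim_filling[OF F k Fk] by (rule block_nonempty[OF h(1,3) k])
    also have "preim n \<mu> (filling F) k = preim n \<mu> (filling F') k" using eq by simp
    finally have "base h (base h i) = base h i'"
      unfolding preim_filling[OF F' k Fk'] hh
      using block_row_iff[OF h(1) base_base[OF h(1)], of "base h i"] by simp
    then have "base h i = base h i'" using base_base[OF h(1)] by simp
    then have "i = i'"
      using off class_base_offset[OF gap_dvd[OF h(1)]] h(2) h'(2) by metis
    then show "F k = F' k" using Fk Fk' hh by simp
  qed
qed

section \<open>Recovering the assignment from a marked tabloid\<close>

lemma rho_tabloidD:
  assumes "Y \<in> rho_tabloids \<rho> \<gamma> n ls \<mu>"
  shows "Y \<in> Bx \<rightarrow>\<^sub>E {1..}"
    and "1 \<le> k \<Longrightarrow> card (preim n \<mu> Y k) = part \<rho> k"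
    and "1 \<le> k \<Longrightarrow> \<exists>h\<in>{1..n}. \<exists>i' j' :: int. \<gamma> h dvd part \<rho> k \<and>
           (\<lambda>(i, j, h). (int i, int j, h)) ` preim n \<mu> Y k =
             {(int s * int (ls h div \<gamma> h) + i', int t + j', h) | s t.
                1 \<le> s \<and> s \<le> \<gamma> h \<and> 1 \<le> t \<and> t \<le> part \<rho> k div \<gamma> h}"
    and "(i, x, h) \<in> Bx \<Longrightarrow> (i, y, h) \<in> Bx \<Longrightarrow> x \<le> y \<Longrightarrow> Y (i, x, h) \<le> Y (i, y, h)"
proof -
  note Y = assms[unfolded rho_tabloids_def mem_Collect_eq]
  show "Y \<in> Bx \<rightarrow>\<^sub>E {1..}" by (rule Y[THEN conjunct1])
  show "card (preim n \<mu> Y k) = part \<rho> k" if "1 \<le> k"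
    using Y[THEN conjunct2, THEN conjunct1] that by blast
  show "\<exists>h\<in>{1..n}. \<exists>i' j' :: int. \<gamma> h dvd part \<rho> k \<and>
           (\<lambda>(i, j, h). (int i, int j, h)) ` preim n \<mu> Y k =
             {(int s * int (ls h div \<gamma> h) + i', int t + j', h) | s t.
                1 \<le> s \<and> s \<le> \<gamma> h \<and> 1 \<le> t \<and> t \<le> part \<rho> k div \<gamma> h}" if "1 \<le> k"
    by (rule Y[THEN conjunct2, THEN conjunct2, THEN conjunct1, rule_format, OF that])
  show "Y (i, x, h) \<le> Y (i, y, h)" if "(i, x, h) \<in> Bx" "(i, y, h) \<in> Bx" "x \<le> y"
    using Y[THEN conjunct2, THEN conjunct2, THEN conjunct2] that by blast
qed

text \<open>The integer offsets are turned into natural numbers by looking at the box with s = t =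
  1. It is a genuine box (b, y, h), which gives i' = b - gap and j' = y - 1 with y at least
  1.\<close>

lemma rho_tabloid_block:
  assumes Y: "Y \<in> rho_tabloids \<rho> \<gamma> n ls \<mu>" and k: "k \<in> I"
  obtains h b a where "h \<in> {1..n}" "\<gamma> h dvd part \<rho> k" "preim n \<mu> Y k = block k h b a"
proof -
  let ?\<phi> = "\<lambda>(i, j, h). (int i, int j, h :: nat)"
  have k1: "1 \<le> k" using k by simp
  obtain h i' j' where h: "h \<in> {1..n}" and d: "\<gamma> h dvd part \<rho> k"
    and eq: "?\<phi> ` preim n \<mu> Y k = {(int s * int (ls h div \<gamma> h) + i', int t + j', h) | s t.
                1 \<le> s \<and> s \<le> \<gamma> h \<and> 1 \<le> t \<and> t \<le> part \<rho> k div \<gamma> h}"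
    using rho_tabloidD(3)[OF Y k1] by blast
  have "\<gamma> h \<le> part \<rho> k" using d k part_\<rho>_pos_iff[of k] by (auto intro: dvd_imp_le)
  then have "1 \<le> part \<rho> k div \<gamma> h" "1 \<le> \<gamma> h"
    using \<gamma>_pos[OF h] by (simp_all add: Suc_le_eq div_greater_zero_iff)
  then have "(int 1 * int (ls h div \<gamma> h) + i', int 1 + j', h) \<in> ?\<phi> ` preim n \<mu> Y k"
    unfolding eq by blast
  then obtain b y where bxy: "(b, y, h) \<in> preim n \<mu> Y k" "int b = int (gap h) + i'" "int y = 1 + j'"
    unfolding ls_div_\<gamma>[OF h] by auto
  have "1 \<le> y" using bxy(1) by (auto simp: preim_def boxes_def)
  then have j': "j' = int (y - 1)" using bxy(3) by simp
  have i': "i' = int b - int (gap h)" using bxy(2) by simp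
  have "?\<phi> ` preim n \<mu> Y k = ?\<phi> ` block k h b (y - 1)"
    unfolding eq int_block[OF h] i' j' ..
  moreover have "inj ?\<phi>" by (auto simp: inj_def)
  ultimately have "preim n \<mu> Y k = block k h b (y - 1)" by (simp add: inj_image_eq_iff)
  then show ?thesis by (rule that[OF h d])
qed

lemma rho_tabloid_value:
  assumes Y: "Y \<in> rho_tabloids \<rho> \<gamma> n ls \<mu>" and b: "b \<in> Bx"
  shows "Y b \<in> I" "b \<in> preim n \<mu> Y (Y b)"
proof -
  show p: "b \<in> preim n \<mu> Y (Y b)" using b by (simp add: preim_def)
  have "Y b \<ge> 1" using PiE_mem[OF rho_tabloidD(1)[OF Y] b] by simp
  then have "card (preim n \<mu> Y (Y b)) = part \<rho> (Y b)" by (rule rho_tabloidD(2)[OF Y])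
  moreover have "finite Bx" using bij_betw_finite[OF std_num_bij] by simp
  then have "finite (preim n \<mu> Y (Y b))" by (simp add: preim_def)
  \<comment> \<open>Finiteness matters because \<open>card\<close> of an infinite set would also be
    0.\<close>
  ultimately have "part \<rho> (Y b) \<noteq> 0" using p by (metis card_eq_0_iff empty_iff)
  then show "Y b \<in> I" using part_\<rho>_pos_iff by simp
qed

text \<open>Blocks cannot straddle two groups of \<open>ls h\<close> equal rows: a block meeting the first row of a
  class covers the same columns in all rows of the class, so the blocks through the first row leave
  no room for a block starting in a later row of the class.\<close>

lemma rho_tabloid_aligned:
  assumes Y: "Y \<in> rho_tabloids \<rho> \<gamma> n ls \<mu>" and h: "h \<in> {1..n}"
  shows "(i, x, h) \<in> Bx \<Longrightarrow> preim n \<mu> Y (Y (i, x, h)) = block (Y (i, x, h)) h b a \<Longrightarrow> b = base h i"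
proof (induction i arbitrary: x b a rule: less_induct)
  case (less i)
  let ?k = "Y (i, x, h)"
  have i: "1 \<le> i" using less.prems(1) by (simp add: boxes_def)
  have "(i, x, h) \<in> block ?k h b a" using rho_tabloid_value(2)[OF Y less.prems(1)] less.prems(2) by simp
  then obtain s t where s: "s < \<gamma> h" "i = b + gap h * s"
    and t: "x = a + t" "1 \<le> t" "t \<le> part \<rho> ?k div \<gamma> h"
    by (auto simp: block_def)
  show ?case
  proof (cases "s = 0")
    \<comment> \<open>The box is not in the top row b of its block. The box of the block in row b
      and the same column is covered by the induction hypothesis, and moving down the class keeps
      the base.\<close>
    case False
    have "(b + gap h * 0, a + t, h) \<in> block ?k h b a"
      unfolding block_def using \<gamma>_pos[OF h] t by blast
    then have "(b, x, h) \<in> preim n \<mu> Y ?k" using less.prems(2) t(1) by simp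
    then have bx: "(b, x, h) \<in> Bx" "Y (b, x, h) = ?k" by (auto simp: preim_def)
    have "b < i" using s(2) False gap_pos[OF h] by simp
    from less.IH[OF this bx(1)] bx(2) less.prems(2) have "b = base h b" by simp
    then show ?thesis using base_row[OF h s(1), of b] s(2) by simp
  next
    case True
    then have ib: "i = b" using s(2) by simp
    show ?thesis
    proof (rule ccontr)
      assume ne: "b \<noteq> base h i"
      let ?i' = "base h i"
      \<comment> \<open>The block through the box above, in the first row of the class and column x,
        is aligned by induction. It therefore contains the present box too and is the same block,
        although its top row would be above b.\<close>
      have lt: "?i' < i" using ne ib class_base_le[OF gap_dvd[OF h] i] by simp
      have "part (\<mu> h) ?i' = part (\<mu> h) i"
        using part_class[OF h _ i base_base[OF h]] by simp
      then have bx: "(?i', x, h) \<in> Bx" using less.prems(1) by (simp add: boxes_def)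
      let ?k' = "Y (?i', x, h)"
      obtain h' b' a' where b': "h' \<in> {1..n}" "preim n \<mu> Y ?k' = block ?k' h' b' a'"
        using rho_tabloid_block[OF Y rho_tabloid_value(1)[OF Y bx]] .
      have mem: "(?i', x, h) \<in> block ?k' h' b' a'" using rho_tabloid_value(2)[OF Y bx] b'(2) by simp
      then have hh: "h' = h" by (auto simp: block_def)
      have "b' = ?i'" using less.IH[OF lt bx] b'(2) base_base[OF h] unfolding hh by simp
      then have "(i, x, h) \<in> block ?k' h b' a'"
        using mem block_row_iff[OF h base_base[OF h] i]
          block_row_iff[OF h base_base[OF h], of ?i'] unfolding hh by simp
      then have "(i, x, h) \<in> preim n \<mu> Y ?k'" using b'(2) hh by simp
      then have "?k' = ?k" by (simp add: preim_def)
      then have "(?i', x, h) \<in> block ?k h b a"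
        using rho_tabloid_value(2)[OF Y bx] less.prems(2) by simp
      then have "b \<le> ?i'" by (auto simp: block_def)
      then show False using lt ib by simp
    qed
  qed
qed

text \<open>The block of k names a class and the mark names a row in it; this row is
  \<open>F k\<close>. The columns need no separate bookkeeping, since weakly increasing rows are
  fixed by their multiplicities.\<close>

lemma marked_surj:
  assumes "(Y, c) \<in> marked_tabloids \<rho> \<gamma> n ls \<mu>"
  obtains F where "F \<in> assignments \<rho>" "filling F = Y" "marking F = c"
proof -
  have Y: "Y \<in> rho_tabloids \<rho> \<gamma> n ls \<mu>"
    and c: "c \<in> I \<rightarrow>\<^sub>E (SIGMA h:{1..n}. carrier (integer_mod_group (\<gamma> h)))"
    and ch: "\<And>k h. k \<in> I \<Longrightarrow> h \<in> {1..n} \<Longrightarrow> preim n \<mu> Y k \<subseteq> {(i, j, h') | i j h'. h' = h} \<Longrightarrow> fst (c k) = h"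
  proof -
    note marked = assms[unfolded marked_tabloids_def Collect_part_\<rho> mem_Collect_eq prod.case]
    show "Y \<in> rho_tabloids \<rho> \<gamma> n ls \<mu>" by (rule marked[THEN conjunct1])
    show "c \<in> I \<rightarrow>\<^sub>E (SIGMA h:{1..n}. carrier (integer_mod_group (\<gamma> h)))"
      by (rule marked[THEN conjunct2, THEN conjunct1])
    show "fst (c k) = h" if "k \<in> I" "h \<in> {1..n}" "preim n \<mu> Y k \<subseteq> {(i, j, h') | i j h'. h' = h}" for k h
    proof -
      have "part \<rho> k \<noteq> 0" using part_\<rho>_pos_iff[of k] that(1) by simp
      then show ?thesis
        by (intro marked[THEN conjunct2, THEN conjunct2, rule_format] conjI that(2,3))
    qed
  qed
  have "\<exists>q. fst q \<in> {1..n} \<and> \<gamma> (fst q) dvd part \<rho> k \<and> base (fst q) (fst (snd q)) = fst (snd q) \<and>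
      preim n \<mu> Y k = block k (fst q) (fst (snd q)) (snd (snd q))" if k: "k \<in> I" for k
  proof -
    obtain h b a where q: "h \<in> {1..n}" "\<gamma> h dvd part \<rho> k" "preim n \<mu> Y k = block k h b a"
      using rho_tabloid_block[OF Y k] .
    have "(b, a + 1, h) \<in> preim n \<mu> Y k" unfolding q(3) by (rule block_nonempty[OF q(1,2) k])
    then have bx: "(b, a + 1, h) \<in> Bx" "Y (b, a + 1, h) = k" by (auto simp: preim_def)
    have "b = base h b" using rho_tabloid_aligned[OF Y q(1) bx(1)] bx(2) q(3) by simp
    then show ?thesis using q by (intro exI[of _ "(h, b, a)"]) simp
  qed
  then have "\<exists>q. \<forall>k\<in>I. fst (q k) \<in> {1..n} \<and> \<gamma> (fst (q k)) dvd part \<rho> k \<and>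
      base (fst (q k)) (fst (snd (q k))) = fst (snd (q k)) \<and>
      preim n \<mu> Y k = block k (fst (q k)) (fst (snd (q k))) (snd (snd (q k)))"
    by (intro bchoice) blast
  then obtain q where q: "\<forall>k\<in>I. fst (q k) \<in> {1..n} \<and> \<gamma> (fst (q k)) dvd part \<rho> k \<and>
      base (fst (q k)) (fst (snd (q k))) = fst (snd (q k)) \<and>
      preim n \<mu> Y k = block k (fst (q k)) (fst (snd (q k))) (snd (snd (q k)))" ..
  define hh where "hh k = fst (q k)" for k
  define bb where "bb k = fst (snd (q k))" for k
  define aa where "aa k = snd (snd (q k))" for k
  have h: "hh k \<in> {1..n}" and d: "\<gamma> (hh k) dvd part \<rho> k" and b: "base (hh k) (bb k) = bb k"
    and pre: "preim n \<mu> Y k = block k (hh k) (bb k) (aa k)" if "k \<in> I" for k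
    using q that by (auto simp: hh_def bb_def aa_def)
  have fst_c: "fst (c k) = hh k" if k: "k \<in> I" for k
    by (rule ch[OF k h[OF k]]) (auto simp: pre[OF k] block_def)
  have snd_c: "0 \<le> snd (c k)" "nat (snd (c k)) < \<gamma> (hh k)" if k: "k \<in> I" for k
  proof -
    have "c k \<in> (SIGMA h:{1..n}. carrier (integer_mod_group (\<gamma> h)))" by (rule PiE_mem[OF c k])
    then have "snd (c k) \<in> carrier (integer_mod_group (\<gamma> (hh k)))"
      using fst_c[OF k] by (cases "c k") auto
    then show "0 \<le> snd (c k)" "nat (snd (c k)) < \<gamma> (hh k)"
      using \<gamma>_pos[OF h[OF k]] by (auto simp: carrier_integer_mod_group split: if_splits)
  qed
  \<comment> \<open>The row at position \<open>c k\<close> in the class of the block; the mark,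
    taken as its representative in 0..<\<gamma>, is small enough to stay in the class.\<close>
  define F where "F = (\<lambda>k\<in>I. (bb k + gap (hh k) * nat (snd (c k)), hh k))"
  have Fk: "F k = (bb k + gap (hh k) * nat (snd (c k)), hh k)" if "k \<in> I" for k
    using that by (simp add: F_def)
  have baseF: "base (hh k) (bb k + gap (hh k) * nat (snd (c k))) = bb k"
    and offF: "class_offset (ls (hh k)) (gap (hh k)) (bb k + gap (hh k) * nat (snd (c k))) = nat (snd (c k))"
    if k: "k \<in> I" for k
    using class_row_arith(2,3)[OF gap_\<gamma>[OF h[OF k]] ls_pos[OF h[OF k]] snd_c(2)[OF k], of "bb k"] b[OF k]
    by simp_all
  have bb1: "1 \<le> bb k" if k: "k \<in> I" for k
    using b[OF k] class_base_ge_1(1)[of "ls (hh k)" "gap (hh k)" "bb k"] by linarith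
  have F_rows: "F k \<in> rows" if k: "k \<in> I" for k
  proof -
    have "(bb k, aa k + 1, hh k) \<in> preim n \<mu> Y k"
      unfolding pre[OF k] by (rule block_nonempty[OF h[OF k] d[OF k] k])
    then have "0 < part (\<mu> (hh k)) (bb k)" by (auto simp: preim_def boxes_def)
    moreover have "part (\<mu> (hh k)) (bb k + gap (hh k) * nat (snd (c k))) = part (\<mu> (hh k)) (bb k)"
      using bb1[OF k] baseF[OF k] b[OF k] by (intro part_class[OF h[OF k]]) auto
    ultimately show ?thesis using h[OF k] bb1[OF k] by (simp add: Fk[OF k] rows_iff)
  qed
  \<comment> \<open>Row by row, Y has the multiplicities prescribed by F. This yields both the sum
    condition on F and, through \<open>mono_eq_Least_card\<close>, the equality of the filling with
    Y.\<close>
  have cnt: "card {x \<in> {1..part (\<mu> h') i}. Y (i, x, h') = k} = mult F (i, h') k"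
    if r: "(i, h') \<in> rows" and k1: "1 \<le> k" for i h' k
  proof (cases "k \<in> I")
    case True
    have i: "1 \<le> i" using r by (simp add: rows_iff)
    have set: "{x \<in> {1..part (\<mu> h') i}. Y (i, x, h') = k} = {x. (i, x, h') \<in> block k (hh k) (bb k) (aa k)}"
      using r unfolding pre[OF True, symmetric] by (auto simp: preim_def boxes_iff_rows)
    show ?thesis
    proof (cases "same_class (F k) (i, h')")
      case sc: True
      then have e: "h' = hh k" "base (hh k) i = bb k"
        using baseF[OF True] by (auto simp: Fk[OF True] same_class_def)
      have "{x. (i, x, h') \<in> block k (hh k) (bb k) (aa k)} = {aa k <.. aa k + part \<rho> k div \<gamma> (hh k)}"
        unfolding e(1) using block_row_iff[OF h[OF True] b[OF True] i] e(2) by auto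
      then show ?thesis unfolding set using sc True e by (simp add: mult_def)
    next
      case nsc: False
      have "(i, x, h') \<notin> block k (hh k) (bb k) (aa k)" for x
      proof
        assume m: "(i, x, h') \<in> block k (hh k) (bb k) (aa k)"
        then have e: "h' = hh k" by (auto simp: block_def)
        then have "base (hh k) i = bb k" using m block_row_iff[OF h[OF True] b[OF True] i] by simp
        then show False using nsc e baseF[OF True] by (simp add: Fk[OF True] same_class_def)
      qed
      then show ?thesis unfolding set using nsc by (simp add: mult_def)
    qed
  next
    case False
    have "Y (i, x, h') \<noteq> k" if "x \<in> {1..part (\<mu> h') i}" for x
      using rho_tabloid_value(1)[OF Y, of "(i, x, h')"] r that False by (auto simp: boxes_iff_rows)
    then have "{x \<in> {1..part (\<mu> h') i}. Y (i, x, h') = k} = {}" by blast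
    moreover have "mult F (i, h') k = 0" using False by (auto simp: mult_def)
    ultimately show ?thesis by (simp only: card.empty)
  qed
  have "cum_mult F p (length \<rho>) = part (\<mu> (snd p)) (fst p)" if p: "p \<in> rows" for p
  proof -
    obtain i h' where ih: "p = (i, h')" by (cases p)
    have "cum_mult F p (length \<rho>) = (\<Sum>k\<in>I. card {x \<in> {1..part (\<mu> h') i}. Y (i, x, h') = k})"
      unfolding cum_mult_def using cnt p by (intro sum.cong) (auto simp: ih)
    also have "\<dots> = card (\<Union>k\<in>I. {x \<in> {1..part (\<mu> h') i}. Y (i, x, h') = k})"
      by (subst card_UN_disjoint) auto
    \<comment> \<open>Every box of the row carries some value in I, so the multiplicities exhaust
      the row.\<close>
    also have "(\<Union>k\<in>I. {x \<in> {1..part (\<mu> h') i}. Y (i, x, h') = k}) = {1..part (\<mu> h') i}"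
      using rho_tabloid_value(1)[OF Y] p by (fastforce simp: ih boxes_iff_rows)
    finally show ?thesis by (simp add: ih)
  qed
  then have F: "F \<in> assignments \<rho>"
    unfolding assignments_def sum_mult using F_rows Fk d by (auto simp: F_def)
  have "filling F = Y"
  proof (rule extensionalityI[of _ Bx])
    show "Y \<in> extensional Bx" using rho_tabloidD(1)[OF Y] by (simp add: PiE_def)
    fix z assume z: "z \<in> Bx"
    obtain i x h' where zz: "z = (i, x, h')" by (cases z)
    have r: "(i, h') \<in> rows" and x: "1 \<le> x" "x \<le> part (\<mu> h') i" using z zz by (auto simp: boxes_iff_rows)
    have bx: "(i, y, h') \<in> Bx" if "1 \<le> y" "y \<le> part (\<mu> h') i" for y
      using that r by (simp add: boxes_iff_rows)
    have "Y (i, x, h') =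
      (LEAST k. x \<le> (\<Sum>k'\<in>{1..k}. card {y \<in> {1..part (\<mu> h') i}. Y (i, y, h') = k'}))"
    proof (rule mono_eq_Least_card)
      fix y y' assume "1 \<le> y" "y \<le> y'" "y' \<le> part (\<mu> h') i"
      then show "Y (i, y, h') \<le> Y (i, y', h')"
        using bx[of y] bx[of y'] by (intro rho_tabloidD(4)[OF Y]) simp_all
    next
      fix y assume "1 \<le> y" "y \<le> part (\<mu> h') i"
      then show "1 \<le> Y (i, y, h')" using rho_tabloid_value(1)[OF Y bx] by simp
    qed (use x in auto)
    also have "\<dots> = (LEAST k. x \<le> cum_mult F (i, h') k)"
      using cnt[OF r] by (simp add: cum_mult_def)
    finally show "filling F z = Y z" using z by (simp add: zz filling_def)
  qed (simp add: filling_def)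
  moreover have "marking F = c"
  proof (rule extensionalityI[of _ I])
    show "c \<in> extensional I" using c by (simp add: PiE_def)
    fix k assume k: "k \<in> I"
    show "marking F k = c k"
      using k fst_c[OF k] snd_c(1)[OF k] offF[OF k] by (simp add: marking_def Fk prod_eq_iff)
  qed (auto simp: marking_def)
  ultimately show ?thesis by (rule that[OF F])
qed

lemma assignment_marked_bij:
  "bij_betw (\<lambda>F. (filling F, marking F)) (assignments \<rho>) (marked_tabloids \<rho> \<gamma> n ls \<mu>)"
  unfolding bij_betw_def
proof
  show "(\<lambda>F. (filling F, marking F)) ` assignments \<rho> = marked_tabloids \<rho> \<gamma> n ls \<mu>"
  proof (intro equalityI subsetI)
    fix z assume z: "z \<in> marked_tabloids \<rho> \<gamma> n ls \<mu>"
    obtain Y c where Yc: "z = (Y, c)" by (cases z)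
    obtain F where "F \<in> assignments \<rho>" "filling F = Y" "marking F = c"
      using marked_surj[OF z[unfolded Yc]] .
    then show "z \<in> (\<lambda>F. (filling F, marking F)) ` assignments \<rho>" using Yc by blast
  qed (use filling_marked in auto)
qed (rule filling_marking_inj)

end

lemma cycle_type_pos:
  assumes "\<sigma> permutes {1..m}" "r \<in> set (cycle_type m \<sigma>)"
  shows "0 < r"
proof -
  obtain ys where ys: "cycle_type m \<sigma> = map card ys" "distinct ys" "set ys = orbit \<sigma> ` {1..m}"
    by (rule cycle_type_orbits)
  then obtain x where x: "x \<in> {1..m}" "r = card (orbit \<sigma> x)" using assms(2) by auto
  have "finite (orbit \<sigma> x)"
    using permutes_orbit_subset[OF assms(1) x(1)] finite_subset by blast
  then show ?thesis using x by (simp add: card_gt_0_iff orbit_nonempty)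
qed

theorem theorem3p2:
  fixes n m :: nat and ms ls \<gamma> :: "nat \<Rightarrow> nat" and \<mu> :: "nat \<Rightarrow> nat list"
    and j :: int and \<sigma> :: "nat \<Rightarrow> nat"
  assumes "n \<ge> 1"
    and "\<And>h. h \<in> {1..n} \<Longrightarrow> ms h > 0"
    and "\<And>h. h \<in> {1..n} \<Longrightarrow> ls h > 0"
    and "m = (\<Sum>h\<in>{1..n}. ms h)"
    and "multi_partition_of n ls \<mu> ms"
    and "\<And>h. h \<in> {1..n} \<Longrightarrow>
           \<gamma> h = group.ord (sym_group (ms h)) (a_perm1 (\<mu> h) (ls h) [^]\<^bsub>sym_group (ms h)\<^esub> j)"
    and "\<sigma> \<in> carrier (sym_group m)"
  shows "\<exists>f. bij_betw f
           {X \<in> tabloids n \<mu>. left_tabloid n \<mu> \<sigma> X =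
              right_tabloid n \<mu> X (a_perm n \<mu> ls [^]\<^bsub>sym_group m\<^esub> (- j))}
           (marked_tabloids (cycle_type m \<sigma>) \<gamma> n ls \<mu>)"
proof -
  interpret multi_l_partition n ms ls \<mu>
    by unfold_locales (rule assms; assumption)+
  have m: "total_size n \<mu> = m" using total_size_eq assms(4) by simp
  have \<sigma>: "\<sigma> permutes {1..total_size n \<mu>}" using assms(7) m by (simp add: sym_group_carrier)
  interpret shifted_multi_l_partition n ms ls \<mu> j \<gamma>
  proof unfold_locales
    fix h assume "h \<in> {1..n}"
    then show "\<gamma> h = ls h div gcd (ls h) (nat \<bar>j\<bar>)" using assms(6) ord_a_perm1_pow by metis
  qed (rule assms(1))
  interpret cycle_filling n ms ls \<mu> j \<gamma> "cycle_type m \<sigma>"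
    by unfold_locales (use cycle_type_pos[OF \<sigma>] m in metis)
  obtain f where f: "bij_betw f {R \<in> rowmaps. \<forall>x\<in>{1..size_m}. R (\<sigma> x) = row_shift (- j) (R x)}
      (assignments (cycle_type m \<sigma>))"
    using rowmap_assignment_bij[OF \<sigma>] m by auto
  \<comment> \<open>The chain is: tabloids, row maps, assignments, marked tabloids.\<close>
  from bij_betw_trans[OF bij_betw_trans[OF bij_betw_inv_into[OF tabloid_rowmap_bij[OF \<sigma>, of j]] f]
      assignment_marked_bij]
  show ?thesis unfolding m by blast
qed

end
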